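(* Let $X$ be a Banach space such that $\operatorname{smo}(X^* )\cap\operatorname{NA}(X)$ is dense in $X^*$. Then, for any $L_1$-predual space $Y$, $$\mathcal{K}(X,Y)=\overline{\mathcal{K}(X,Y)\cap\operatorname{RSE}(X,Y)}.$$
   Context: Banach spaces are over $\mathbb{K}$, where $\mathbb{K}=\mathbb{R}$ or $\mathbb{C}$, and are nonzero. $\mathbb{T}=\{\theta\in\mathbb{K}\colon|\theta|=1\}$; $B_X$, $S_X$ are the closed unit ball and unit sphere; $\mathcal{L}(X,Y)$ is the space of bounded linear operators with the operator norm, closures of sets of operators are in this norm, and $\mathcal{K}(X,Y)$ is the set of compact operators. $\operatorname{NA}(X)$ is the set of $x^*\in X^*$ with $|x^*(x)|=\|x^*\|$ for some $x\in B_X$. $\operatorname{smo}(X^* )$ is the set of points of $X^*$ at which the norm of $X^*$ is G\^ateaux differentiable. An $L_1$-predual is a Banach space whose dual is isometrically isomorphic to $L_1(\mu)$ for some measure $\mu$. $T\in\operatorname{RSE}(X,Y)$ (range strongly exposing) means: there exists $x_0\in S_X$ such that whenever $(x_n)\subseteq B_X$ satisfies $\|Tx_n\|\to\|T\|$, there are a subsequence $(x_{\sigma(n)})$ and $\theta\in\mathbb{T}$ with $Tx_{\sigma(n)}\to\theta Tx_0$ in norm. *)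

theory Defs
  imports "HOL-Analysis.Analysis"
begin

text \<open>
  The scalar field \<open>\<bbbK>\<close>: up to isometric isomorphism this class has exactly the members
  \<open>\<real>\<close> and \<open>\<complex>\<close>. The superclasses \<open>banach\<close> and \<open>second_countable_topology\<close> are
  consequences of the axiom, listed because the Bochner integral needs them as sorts.
\<close>

class real_or_complex_field = real_normed_field + banach + second_countable_topology +
  assumes real_or_complex:
    "(\<forall>z. \<exists>a. z = a *\<^sub>R 1) \<or>
     (\<exists>i. i * i = - 1 \<and> (\<forall>z. \<exists>a b. z = a *\<^sub>R 1 + b *\<^sub>R i) \<and>
          (\<forall>a b. norm (a *\<^sub>R 1 + b *\<^sub>R i) = sqrt (a\<^sup>2 + b\<^sup>2)))"

instance real :: real_or_complex_field
  by standard auto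

instance complex :: real_or_complex_field
proof
  have "z = Re z *\<^sub>R 1 + Im z *\<^sub>R \<i>" for z :: complex
    by (simp add: complex_eq_iff)
  moreover have "norm (a *\<^sub>R 1 + b *\<^sub>R \<i>) = sqrt (a\<^sup>2 + b\<^sup>2)" for a b
    by (simp add: cmod_def)
  ultimately show "(\<forall>z::complex. \<exists>a. z = a *\<^sub>R 1) \<or>
     (\<exists>i::complex. i * i = - 1 \<and> (\<forall>z. \<exists>a b. z = a *\<^sub>R 1 + b *\<^sub>R i) \<and>
          (\<forall>a b. norm (a *\<^sub>R 1 + b *\<^sub>R i) = sqrt (a\<^sup>2 + b\<^sup>2)))"
    by (intro disjI2 exI[of _ \<i>]) (simp, blast)
qed

text \<open>
  A nonzero Banach space over \<open>\<bbbK>\<close>: a real Banach space (as a type) with a compatible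
  multiplication by scalars from \<open>\<bbbK>\<close>.
\<close>

locale banach_space_over = vector_space scale
  for scale :: "'k::real_or_complex_field \<Rightarrow> 'a::banach \<Rightarrow> 'a" +
  assumes scale_of_real: "scale (of_real r) x = r *\<^sub>R x"
    and norm_scale: "norm (scale c x) = norm c * norm x"
    and nonzero: "\<exists>x::'a. x \<noteq> 0"

text \<open>
  The elements of the library type \<open>'a \<Rightarrow>\<^sub>L 'b\<close> are only real-linear, so \<open>\<L>(X,Y)\<close> is
  its closed subspace of \<open>\<bbbK>\<close>-linear operators. The norm and the topology are those of
  \<open>'a \<Rightarrow>\<^sub>L 'b\<close>, that is, the operator norm and its topology.
\<close>

definition bounded_ops ::
  "('k::real_or_complex_field \<Rightarrow> 'a::banach \<Rightarrow> 'a) \<Rightarrow> ('k \<Rightarrow> 'b::banach \<Rightarrow> 'b) \<Rightarrow> ('a \<Rightarrow>\<^sub>L 'b) set"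
  where "bounded_ops sX sY =
    {T. \<forall>c x. blinfun_apply T (sX c x) = sY c (blinfun_apply T x)}"

definition dual_space ::
  "('k::real_or_complex_field \<Rightarrow> 'a::banach \<Rightarrow> 'a) \<Rightarrow> ('a \<Rightarrow>\<^sub>L 'k) set"
  where "dual_space sX = bounded_ops sX (*)"

definition compact_ops ::
  "('k::real_or_complex_field \<Rightarrow> 'a::banach \<Rightarrow> 'a) \<Rightarrow> ('k \<Rightarrow> 'b::banach \<Rightarrow> 'b) \<Rightarrow> ('a \<Rightarrow>\<^sub>L 'b) set"
  where "compact_ops sX sY =
    {T \<in> bounded_ops sX sY. compact (closure (blinfun_apply T ` cball 0 1))}"

definition norm_attaining ::
  "('k::real_or_complex_field \<Rightarrow> 'a::banach \<Rightarrow> 'a) \<Rightarrow> ('a \<Rightarrow>\<^sub>L 'k) set"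
  where "norm_attaining sX =
    {f \<in> dual_space sX. \<exists>x. norm x \<le> 1 \<and> norm (blinfun_apply f x) = norm f}"

text \<open>
  Gateaux differentiability at \<open>x\<close> of a real-valued function on the real linear subspace \<open>V\<close>
  of a normed space, with a bounded real-linear derivative \<open>D\<close> on \<open>V\<close>.
\<close>

definition gateaux_differentiable_in ::
  "'v::real_normed_vector set \<Rightarrow> ('v \<Rightarrow> real) \<Rightarrow> 'v \<Rightarrow> bool"
  where "gateaux_differentiable_in V \<phi> x \<longleftrightarrow>
    (\<exists>D :: 'v \<Rightarrow> real.
       (\<forall>h\<in>V. \<forall>k\<in>V. D (h + k) = D h + D k) \<and>
       (\<forall>r. \<forall>h\<in>V. D (r *\<^sub>R h) = r * D h) \<and>
       (\<exists>C. \<forall>h\<in>V. \<bar>D h\<bar> \<le> C * norm h) \<and>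
       (\<forall>h\<in>V. ((\<lambda>t. (\<phi> (x + t *\<^sub>R h) - \<phi> x) / t) \<longlongrightarrow> D h) (at 0)))"

definition smooth_dual_points ::
  "('k::real_or_complex_field \<Rightarrow> 'a::banach \<Rightarrow> 'a) \<Rightarrow> ('a \<Rightarrow>\<^sub>L 'k) set"
  where "smooth_dual_points sX =
    {f \<in> dual_space sX. gateaux_differentiable_in (dual_space sX) norm f}"

definition range_strongly_exposing ::
  "('k::real_or_complex_field \<Rightarrow> 'a::banach \<Rightarrow> 'a) \<Rightarrow> ('k \<Rightarrow> 'b::banach \<Rightarrow> 'b) \<Rightarrow> ('a \<Rightarrow>\<^sub>L 'b) set"
  where "range_strongly_exposing sX sY =
    {T \<in> bounded_ops sX sY.
      \<exists>x\<^sub>0. norm x\<^sub>0 = 1 \<and>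
        (\<forall>x :: nat \<Rightarrow> 'a.
           (\<forall>n. norm (x n) \<le> 1) \<and> (\<lambda>n. norm (blinfun_apply T (x n))) \<longlonglongrightarrow> norm T \<longrightarrow>
           (\<exists>(\<sigma> :: nat \<Rightarrow> nat) \<theta>. strict_mono \<sigma> \<and> norm \<theta> = 1 \<and>
              (\<lambda>n. blinfun_apply T (x (\<sigma> n))) \<longlonglongrightarrow> sY \<theta> (blinfun_apply T x\<^sub>0)))}"

text \<open>The elements of \<open>L\<^sub>1(\<mu>)\<close> are the classes of integrable functions modulo equality a.e.\<close>

definition L1_class ::
  "'m measure \<Rightarrow> ('m \<Rightarrow> 'k::real_or_complex_field) \<Rightarrow> ('m \<Rightarrow> 'k) set"
  where "L1_class \<mu> f = {g. integrable \<mu> g \<and> (AE t in \<mu>. g t = f t)}"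

definition L1_space :: "'m measure \<Rightarrow> ('m \<Rightarrow> 'k::real_or_complex_field) set set"
  where "L1_space \<mu> = L1_class \<mu> ` {f. integrable \<mu> f}"

definition dual_isometric_to_L1 ::
  "('k::real_or_complex_field \<Rightarrow> 'b::banach \<Rightarrow> 'b) \<Rightarrow> 'm measure \<Rightarrow> bool"
  where "dual_isometric_to_L1 sY \<mu> \<longleftrightarrow>
    (\<exists>\<Phi> :: ('m \<Rightarrow> 'k) set \<Rightarrow> ('b \<Rightarrow>\<^sub>L 'k).
       bij_betw \<Phi> (L1_space \<mu>) (dual_space sY) \<and>
       (\<forall>f g. integrable \<mu> f \<and> integrable \<mu> g \<longrightarrow>
          \<Phi> (L1_class \<mu> (\<lambda>t. f t + g t)) = \<Phi> (L1_class \<mu> f) + \<Phi> (L1_class \<mu> g)) \<and>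
       (\<forall>c f y. integrable \<mu> f \<longrightarrow>
          blinfun_apply (\<Phi> (L1_class \<mu> (\<lambda>t. c * f t))) y =
            c * blinfun_apply (\<Phi> (L1_class \<mu> f)) y) \<and>
       (\<forall>f. integrable \<mu> f \<longrightarrow>
          norm (\<Phi> (L1_class \<mu> f)) = (\<integral>t. norm (f t) \<partial>\<mu>)))"

text \<open>
  HOL cannot quantify existentially over the type underlying the measure space, so that type is
  a parameter; in a hypothesis, a free type variable \<open>'m\<close> amounts to an arbitrary measure space.
\<close>

definition L1_predual ::
  "'m itself \<Rightarrow> ('k::real_or_complex_field \<Rightarrow> 'b::banach \<Rightarrow> 'b) \<Rightarrow> bool"
  where "L1_predual M sY \<longleftrightarrow>
    banach_space_over sY \<and> (\<exists>\<mu> :: 'm measure. dual_isometric_to_L1 sY \<mu>)"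

end

theory Submission
  imports Defs
begin

text \<open>
  Let \<open>T\<close> be a nonzero compact operator and \<open>\<tau> = \<parallel>T\<parallel>\<close>. The operator near \<open>T\<close> that is range strongly
  exposing has the form \<open>S x = f(x) y + R x\<close>, where \<open>f \<in> smo(X\<^sup>*) \<inter> NA(X)\<close>, \<open>y \<in> Y\<close> has norm one, \<open>R\<close>
  is compact and, for some \<open>r < \<parallel>f\<parallel>\<close>,
  \<open>\<parallel>b y + R x\<parallel> \<le> max |b| r\<close> for all scalars \<open>b\<close> and all \<open>x\<close> in the unit ball.
  Then \<open>\<parallel>S x\<^sub>n\<parallel> \<rightarrow> \<parallel>S\<parallel>\<close> forces \<open>|f(x\<^sub>n)| \<rightarrow> \<parallel>f\<parallel>\<close>. By the argument of Smulyan, smoothness of the norm at \<open>f\<close>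
  and the fact that \<open>f\<close> attains its norm at some \<open>x\<^sub>0\<close> make the \<open>x\<^sub>n\<close>, after multiplication by scalars of
  modulus one and passage to a subsequence, converge weakly to \<open>x\<^sub>0\<close>; compactness of \<open>S\<close> turns this into norm
  convergence of the images (\<open>Smulyan\<close>, \<open>range_strongly_exposingI\<close>).

  The geometry of \<open>Y\<close> produces \<open>y\<close> and \<open>R\<close>. Choose an extreme point \<open>\<phi>\<close> of the dual ball of \<open>Y\<close> that is
  norming for a vector \<open>T x\<close> of norm almost \<open>\<tau>\<close>. It exists because a Hahn-Banach extension
  that takes the largest admissible value at each step is automatically extreme (\<open>Hahn_Banach_extreme\<close>).
  As \<open>Y\<^sup>*\<close> is an \<open>L\<^sub>1\<close> space, \<open>\<phi>\<close> is carried by an atom, so that \<open>Y\<^sup>*\<close> is the \<open>\<ell>\<^sub>1\<close>-sum of the line through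
  \<open>\<phi>\<close> and a complement (\<open>extreme_functional_L_summand\<close>). Dually, \<open>Y\<^sup>*\<^sup>*\<close> is an \<open>\<ell>\<^sub>\<infinity>\<close>-sum whose first
  summand is spanned by the coefficient functional \<open>\<alpha>\<close> of \<open>\<phi>\<close>, the indicator of the atom. In the bidual,
  \<open>\<alpha>\<close> could serve as \<open>y\<close>, with \<open>R\<close> the component of \<open>T\<close> in the second summand.

  A version of Helly's theorem (\<open>Helly_compact\<close>) replaces an element of the bidual by an element of \<open>Y\<close> that
  satisfies compactly many norm inequalities up to \<open>\<epsilon>\<close> and one equation exactly. It gives an
  approximate peak \<open>y\<^sub>0\<close> with \<open>\<phi>(y\<^sub>0) = 1\<close>, hence \<open>T = f\<^sub>0(\<cdot>) y\<^sub>0 + R\<^sub>0\<close> with \<open>f\<^sub>0 = \<phi> \<circ> T\<close> and \<open>R\<^sub>0\<close> mapping into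
  \<open>ker \<phi>\<close> (\<open>approximate_peak\<close>). Shrinking \<open>R\<^sub>0\<close> slightly leaves room for the iteration in \<open>exact_peak\<close>,
  which moves \<open>y\<^sub>0\<close> to a nearby \<open>y\<close> for which the inequalities hold without error. Finally \<open>f\<^sub>0\<close> is
  replaced by a nearby \<open>f \<in> smo(X\<^sup>*) \<inter> NA(X)\<close>.
\<close>

section \<open>Hahn-Banach extensions that are extreme points\<close>

text \<open>
  Partial linear functionals are encoded by their graphs, which are subspaces of the product, so that extension is
  inclusion and unions of chains need no gluing. Domination by a sublinear \<open>p\<close> makes such a subspace single-valued. The last
  condition is extremality: since \<open>r\<close> is the midpoint of \<open>g x\<close> and \<open>2 r - g x\<close>, it says that the partial
  functional is not a proper midpoint of two dominated linear ones. The competitors \<open>g\<close> are total, which makes the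
  condition pass to unions of chains.
\<close>

definition dominated_extremal_graph ::
  "('v::real_vector \<Rightarrow> real) \<Rightarrow> ('v \<times> real) set \<Rightarrow> bool"
  where "dominated_extremal_graph p G \<longleftrightarrow>
    subspace G \<and> (\<forall>x r. (x, r) \<in> G \<longrightarrow> r \<le> p x) \<and>
    (\<forall>g. linear g \<longrightarrow> (\<forall>x r. (x, r) \<in> G \<longrightarrow> g x \<le> p x \<and> 2 * r - g x \<le> p x) \<longrightarrow>
       (\<forall>x r. (x, r) \<in> G \<longrightarrow> g x = r))"

text \<open>
  The one-step extension of Hahn and Banach. Two dominated functionals that average to the extension agree with it on the
  old domain and have values at most \<open>s\<close> at \<open>y\<close>, by the choice of \<open>s\<close> as the largest possible value;
  as their mean at \<open>y\<close> is \<open>s\<close>, they both take this value.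
\<close>

lemma dominated_extremal_graph_extend:
  fixes p :: "'v::real_vector \<Rightarrow> real"
  assumes sub: "\<And>x y. p (x + y) \<le> p x + p y"
    and hom: "\<And>t x. 0 \<le> t \<Longrightarrow> p (t *\<^sub>R x) = t * p x"
    and G: "dominated_extremal_graph p G"
  obtains G' where "dominated_extremal_graph p G'" "G \<subseteq> G'" "y \<in> fst ` G'"
proof -
  have GS: "subspace G" and Gp: "\<And>x r. (x, r) \<in> G \<Longrightarrow> r \<le> p x"
    and Gext: "\<And>g x r. linear g \<Longrightarrow> (\<And>x r. (x, r) \<in> G \<Longrightarrow> g x \<le> p x \<and> 2 * r - g x \<le> p x) \<Longrightarrow>
       (x, r) \<in> G \<Longrightarrow> g x = r"
    using G unfolding dominated_extremal_graph_def by blast+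
  have G0: "(0, 0) \<in> G"
    using subspace_0[OF GS] by (simp add: zero_prod_def)
  \<comment> \<open>The largest value at \<open>y\<close> that domination permits; taking the largest one keeps extremality.\<close>
  define s where "s = (INF z\<in>G. p (fst z + y) - snd z)"
  have bound: "r' - p (x' - y) \<le> p (x + y) - r" if "(x, r) \<in> G" "(x', r') \<in> G" for x r x' r'
  proof -
    have "(x + x', r + r') \<in> G" using subspace_add[OF GS that] by simp
    from Gp[OF this] have "r + r' \<le> p ((x + y) + (x' - y))" by simp
    also have "\<dots> \<le> p (x + y) + p (x' - y)" by (rule sub)
    finally show ?thesis by simp
  qed
  have bdd: "bdd_below ((\<lambda>z. p (fst z + y) - snd z) ` G)"
    using bound[OF _ G0] by (intro bdd_belowI2[of _ "0 - p (0 - y)"]) auto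
  have s_le: "s \<le> p (x + y) - r" if "(x, r) \<in> G" for x r
    unfolding s_def using cINF_lower[OF bdd that] by simp
  have s_ge: "r' - p (x' - y) \<le> s" if "(x', r') \<in> G" for x' r'
    unfolding s_def using bound[OF _ that] G0 by (intro cINF_greatest) auto
  define G' where "G' = {z + t *\<^sub>R (y, s) | z t. z \<in> G}"
  have G'S: "subspace G'"
  proof (rule subspaceI)
    show "0 \<in> G'" unfolding G'_def
      using subspace_0[OF GS] by (intro CollectI exI[of _ 0] exI[of _ "0::real"]) (simp_all add: prod_eq_iff)
    fix a b assume "a \<in> G'" "b \<in> G'"
    then obtain z t z' t' where "z \<in> G" "z' \<in> G" "a = z + t *\<^sub>R (y, s)" "b = z' + t' *\<^sub>R (y, s)"
      unfolding G'_def by blast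
    then show "a + b \<in> G'" unfolding G'_def
      by (intro CollectI exI[of _ "z + z'"] exI[of _ "t + t'"])
        (auto simp: subspace_add[OF GS] scaleR_left_distrib algebra_simps)
  next
    fix c a assume "a \<in> G'"
    then obtain z t where "z \<in> G" "a = z + t *\<^sub>R (y, s)" unfolding G'_def by blast
    then show "c *\<^sub>R a \<in> G'" unfolding G'_def
      by (intro CollectI exI[of _ "c *\<^sub>R z"] exI[of _ "c * t"])
        (auto simp: subspace_scale[OF GS] scaleR_right_distrib algebra_simps)
  qed
  have G'p: "r \<le> p x" if "(x, r) \<in> G'" for x r
  proof -
    from that obtain x0 r0 t where z: "(x0, r0) \<in> G" and x: "x = x0 + t *\<^sub>R y" "r = r0 + t * s"
      unfolding G'_def by (auto simp: prod_eq_iff)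
    consider "t = 0" | "t > 0" | "t < 0" by linarith
    then show ?thesis
    proof cases
      case 1 then show ?thesis using Gp[OF z] x by simp
    next
      case 2
      have "((1/t) *\<^sub>R x0, (1/t) * r0) \<in> G" using subspace_scale[OF GS z, of "1/t"] by simp
      from s_le[OF this] have "t * s \<le> t * (p ((1/t) *\<^sub>R x0 + y) - (1/t) * r0)"
        using 2 by (intro mult_left_mono) auto
      also have "\<dots> = t * p ((1/t) *\<^sub>R x0 + y) - r0" using 2 by (simp add: algebra_simps)
      also have "t * p ((1/t) *\<^sub>R x0 + y) = p (t *\<^sub>R ((1/t) *\<^sub>R x0 + y))" using 2 hom by simp
      also have "t *\<^sub>R ((1/t) *\<^sub>R x0 + y) = x" using 2 x by (simp add: scaleR_right_distrib)
      finally show ?thesis using x by simp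
    next
      case 3
      define u where "u = - t"
      have u: "u > 0" using 3 u_def by simp
      have "((1/u) *\<^sub>R x0, (1/u) * r0) \<in> G" using subspace_scale[OF GS z, of "1/u"] by simp
      from s_ge[OF this] have "u * ((1/u) * r0 - p ((1/u) *\<^sub>R x0 - y)) \<le> u * s"
        using u by (intro mult_left_mono) auto
      moreover have "u * ((1/u) * r0 - p ((1/u) *\<^sub>R x0 - y)) = r0 - u * p ((1/u) *\<^sub>R x0 - y)"
        using u by (simp add: algebra_simps)
      moreover have "u * p ((1/u) *\<^sub>R x0 - y) = p (u *\<^sub>R ((1/u) *\<^sub>R x0 - y))" using u hom by simp
      moreover have "u *\<^sub>R ((1/u) *\<^sub>R x0 - y) = x" using u x by (simp add: scaleR_right_diff_distrib u_def)
      ultimately show ?thesis using x u_def by simp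
    qed
  qed
  have sub_GG': "G \<subseteq> G'" unfolding G'_def
  proof
    fix z assume "z \<in> G"
    then show "z \<in> {z + t *\<^sub>R (y, s) | z t. z \<in> G}"
      by (intro CollectI exI[of _ z] exI[of _ "0::real"]) (simp add: prod_eq_iff)
  qed
  have ys: "(y, s) \<in> G'" unfolding G'_def
    using G0 by (intro CollectI exI[of _ "(0, 0)"] exI[of _ 1]) simp
  have ext: "g x = r" if g: "linear g"
    and le: "\<And>x r. (x, r) \<in> G' \<Longrightarrow> g x \<le> p x \<and> 2 * r - g x \<le> p x" and xr: "(x, r) \<in> G'" for g x r
  proof -
    interpret linear g by fact
    have gG: "g x = r" if "(x, r) \<in> G" for x r
      using Gext[OF g _ that] le sub_GG' by blast
    have "g y \<le> p (x + y) - r" if "(x, r) \<in> G" for x r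
    proof -
      have "(x + y, r + s) \<in> G'" using subspace_add[OF G'S, of "(x, r)" "(y, s)"] that sub_GG' ys by auto
      from le[OF this] show ?thesis using gG[OF that] by (simp add: add)
    qed
    then have "g y \<le> s" unfolding s_def using G0 by (intro cINF_greatest) auto
    moreover have "2 * s - g y \<le> p (x + y) - r" if "(x, r) \<in> G" for x r
    proof -
      have "(x + y, r + s) \<in> G'" using subspace_add[OF G'S, of "(x, r)" "(y, s)"] that sub_GG' ys by auto
      from le[OF this] show ?thesis using gG[OF that] by (simp add: add)
    qed
    then have "2 * s - g y \<le> s" unfolding s_def using G0 by (intro cINF_greatest) auto
    ultimately have "g y = s" by simp
    moreover obtain x0 r0 t where "(x0, r0) \<in> G" "x = x0 + t *\<^sub>R y" "r = r0 + t * s"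
      using xr unfolding G'_def by (auto simp: prod_eq_iff)
    ultimately show ?thesis using gG by (simp add: add scale)
  qed
  have "dominated_extremal_graph p G'"
    unfolding dominated_extremal_graph_def using G'S G'p ext by blast
  with sub_GG' ys show thesis by (intro that) force+
qed

text \<open>
  Zorn's lemma applied to dominated extremal graphs, starting with the line through \<open>v\<close>. For the norm as \<open>p\<close> this yields an extreme
  point of the dual ball that is norming for \<open>v\<close>; for the distance to a subspace, the first three conclusions are the
  separation theorem behind \<open>Helly_finite\<close>.
\<close>

theorem Hahn_Banach_extreme:
  fixes p :: "'v::real_vector \<Rightarrow> real"
  assumes sub: "\<And>x y. p (x + y) \<le> p x + p y"
    and hom: "\<And>t x. 0 \<le> t \<Longrightarrow> p (t *\<^sub>R x) = t * p x"
  obtains f where "linear f" "\<And>x. f x \<le> p x" "f v = p v"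
    "\<And>g. linear g \<Longrightarrow> (\<And>x. g x \<le> p x) \<Longrightarrow> (\<And>x. 2 * f x - g x \<le> p x) \<Longrightarrow> g = f"
proof -
  define \<A> where "\<A> = {G. dominated_extremal_graph p G \<and> (v, p v) \<in> G}"
  define G0 where "G0 = range (\<lambda>t. t *\<^sub>R (v, p v))"
  have p0: "p 0 = 0" using hom[of 0 0] by simp
  have "subspace G0" unfolding G0_def
    by (metis span_breakdown_eq span_singleton subspace_span)
  moreover have "r \<le> p x" if xr: "(x, r) \<in> G0" for x r
  proof -
    obtain t where t: "x = t *\<^sub>R v" "r = t * p v" using xr unfolding G0_def by auto
    show ?thesis
    proof (cases "t \<ge> 0")
      case True then show ?thesis using t hom by simp
    next
      case False
      have "0 \<le> p ((-t) *\<^sub>R v) + p (t *\<^sub>R v)" using sub[of "(-t) *\<^sub>R v" "t *\<^sub>R v"] p0 by simp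
      then show ?thesis using t hom[of "-t" v] False by simp
    qed
  qed
  moreover have "g x = r" if g: "linear g"
    and le: "\<And>x r. (x, r) \<in> G0 \<Longrightarrow> g x \<le> p x \<and> 2 * r - g x \<le> p x" and xr: "(x, r) \<in> G0" for g x r
  proof -
    have vG: "(v, p v) \<in> G0" unfolding G0_def by (rule range_eqI[of _ _ 1]) simp
    from le[OF this] have "g v = p v" by simp
    moreover obtain t where "x = t *\<^sub>R v" "r = t * p v" using xr unfolding G0_def by auto
    ultimately show ?thesis using linear_scale[OF g] by simp
  qed
  moreover have "(v, p v) \<in> G0" unfolding G0_def by (rule range_eqI[of _ _ 1]) simp
  ultimately have "G0 \<in> \<A>" unfolding \<A>_def dominated_extremal_graph_def by blast
  moreover have "\<Union>C \<in> \<A>" if C: "C \<noteq> {}" "subset.chain \<A> C" for C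
  proof -
    have CA: "\<And>G. G \<in> C \<Longrightarrow> dominated_extremal_graph p G \<and> (v, p v) \<in> G"
      using C(2) unfolding subset.chain_def \<A>_def by blast
    have CS: "\<And>G. G \<in> C \<Longrightarrow> subspace G" using CA unfolding dominated_extremal_graph_def by blast
    have tot: "\<And>G H. G \<in> C \<Longrightarrow> H \<in> C \<Longrightarrow> G \<subseteq> H \<or> H \<subseteq> G"
      using C(2) unfolding subset.chain_def by blast
    have "subspace (\<Union>C)"
    proof (rule subspaceI)
      show "0 \<in> \<Union>C" using C(1) CS subspace_0 by blast
      fix a b assume "a \<in> \<Union>C" "b \<in> \<Union>C"
      then obtain G where "G \<in> C" "a \<in> G" "b \<in> G" using tot by blast
      then show "a + b \<in> \<Union>C" using CS subspace_add by blast
    next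
      fix c a assume "a \<in> \<Union>C"
      then show "c *\<^sub>R a \<in> \<Union>C" using CS subspace_scale by blast
    qed
    moreover have "\<forall>x r. (x, r) \<in> \<Union>C \<longrightarrow> r \<le> p x"
      using CA unfolding dominated_extremal_graph_def by blast
    moreover have "g x = r" if g: "linear g"
      and le: "\<forall>x r. (x, r) \<in> \<Union>C \<longrightarrow> g x \<le> p x \<and> 2 * r - g x \<le> p x" and xr: "(x, r) \<in> \<Union>C" for g x r
    proof -
      obtain G where G: "G \<in> C" "(x, r) \<in> G" using xr by blast
      then have "\<forall>x r. (x, r) \<in> G \<longrightarrow> g x \<le> p x \<and> 2 * r - g x \<le> p x" using le by blast
      then show ?thesis using CA[OF G(1)] g G(2) unfolding dominated_extremal_graph_def by blast
    qed
    moreover have "(v, p v) \<in> \<Union>C" using C(1) CA by blast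
    ultimately show ?thesis unfolding \<A>_def dominated_extremal_graph_def by blast
  qed
  ultimately obtain G where GA: "G \<in> \<A>" and Gmax: "\<And>H. H \<in> \<A> \<Longrightarrow> G \<subseteq> H \<Longrightarrow> H = G"
    using subset_Zorn_nonempty[of \<A>] by blast
  have G: "dominated_extremal_graph p G" and vG: "(v, p v) \<in> G" using GA unfolding \<A>_def by auto
  have GS: "subspace G" and Gp: "\<And>x r. (x, r) \<in> G \<Longrightarrow> r \<le> p x"
    using G unfolding dominated_extremal_graph_def by blast+
  have dom: "\<exists>r. (y, r) \<in> G" for y
  proof -
    obtain G' where G': "dominated_extremal_graph p G'" "G \<subseteq> G'" "y \<in> fst ` G'"
      using dominated_extremal_graph_extend[OF sub hom G, of y] by blast
    then have "G' = G" using Gmax[of G'] vG unfolding \<A>_def by blast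
    then show ?thesis using G'(3) by force
  qed
  have uniq: "r = r'" if "(x, r) \<in> G" "(x, r') \<in> G" for x r r'
    using Gp[of 0 "r - r'"] Gp[of 0 "r' - r"] subspace_diff[OF GS that] subspace_diff[OF GS that(2,1)] p0
    by simp
  define f where "f x = (SOME r. (x, r) \<in> G)" for x
  have fG: "(x, f x) \<in> G" for x unfolding f_def using someI_ex[OF dom] .
  have fI: "f x = r" if "(x, r) \<in> G" for x r using uniq[OF fG that] .
  have lin: "linear f"
  proof (rule linearI)
    fix a b show "f (a + b) = f a + f b"
      using fI subspace_add[OF GS fG[of a] fG[of b]] by simp
    fix c show "f (c *\<^sub>R a) = c *\<^sub>R f a"
      using fI subspace_scale[OF GS fG[of a], of c] by simp
  qed
  show thesis
  proof (rule that[OF lin])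
    show "f x \<le> p x" for x using Gp[OF fG] .
    show "f v = p v" using fI[OF vG] .
    show "g = f" if g: "linear g" "\<And>x. g x \<le> p x" "\<And>x. 2 * f x - g x \<le> p x" for g
    proof -
      have "\<forall>x r. (x, r) \<in> G \<longrightarrow> g x \<le> p x \<and> 2 * r - g x \<le> p x" using g(2,3) fI by metis
      then show ?thesis using G g(1) fG unfolding dominated_extremal_graph_def by blast
    qed
  qed
qed

section \<open>Real parts in the scalar field\<close>

text \<open>
  In the complex case \<open>re\<close> is the usual real part and \<open>\<iota>\<close> an imaginary unit; in the real case \<open>re\<close>
  is the identity and \<open>\<iota> = 0\<close>. With this convention one formula recovers \<open>z\<close> from real parts in
  both cases, and later proofs need no case distinction on the field.
\<close>

definition is_real_part :: "('k::real_or_complex_field \<Rightarrow> real) \<Rightarrow> 'k \<Rightarrow> bool"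
  where "is_real_part re \<iota> \<longleftrightarrow> linear re \<and> re 1 = 1 \<and> (\<forall>z. \<bar>re z\<bar> \<le> norm z) \<and>
     re \<iota> = 0 \<and> (\<iota> = 0 \<or> \<iota> * \<iota> = - 1) \<and> (\<forall>z. z = re z *\<^sub>R 1 - re (\<iota> * z) *\<^sub>R \<iota>)"

lemma real_part_exists:
  "\<exists>(re :: 'k::real_or_complex_field \<Rightarrow> real) \<iota>. is_real_part re \<iota>"
proof -
  consider "\<forall>z::'k. \<exists>a. z = a *\<^sub>R 1"
    | i :: 'k where "i * i = - 1" "\<forall>z. \<exists>a b. z = a *\<^sub>R 1 + b *\<^sub>R i"
        "\<forall>a b. norm (a *\<^sub>R 1 + b *\<^sub>R i) = sqrt (a\<^sup>2 + b\<^sup>2)"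
    using real_or_complex[where 'a = 'k] by blast
  then show ?thesis
  proof cases
    case 1
    then obtain re :: "'k \<Rightarrow> real" where re: "\<And>z. z = re z *\<^sub>R 1" by metis
    have eq: "re z = a" if "z = a *\<^sub>R 1" for z a using re[of z] that by simp
    have "linear re"
    proof (rule linearI)
      fix a b :: 'k show "re (a + b) = re a + re b"
        by (rule eq) (use re[of a] re[of b] in \<open>simp add: scaleR_left_distrib\<close>)
      fix c show "re (c *\<^sub>R a) = c *\<^sub>R re a"
        by (rule eq) (metis re scaleR_scaleR real_scaleR_def)
    qed
    moreover have "\<bar>re z\<bar> \<le> norm z" for z using arg_cong[OF re[of z], of norm] by simp
    moreover have "re 1 = 1" "re 0 = 0" by (auto intro: eq)
    ultimately show ?thesis unfolding is_real_part_def using re by (intro exI[of _ re] exI[of _ 0]) auto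
  next
    case 2
    from 2(2) obtain re im :: "'k \<Rightarrow> real" where re: "\<And>z. z = re z *\<^sub>R 1 + im z *\<^sub>R i" by metis
    have eq: "re z = a \<and> im z = b" if "z = a *\<^sub>R 1 + b *\<^sub>R i" for z a b
    proof -
      have "(re z - a) *\<^sub>R 1 + (im z - b) *\<^sub>R i = 0" using re[of z] that by (simp add: algebra_simps)
      then have "sqrt ((re z - a)\<^sup>2 + (im z - b)\<^sup>2) = 0" using 2(3) by (metis norm_zero)
      then show ?thesis by (simp add: add_nonneg_eq_0_iff)
    qed
    have "linear re"
    proof (rule linearI)
      fix a b :: 'k
      have "a + b = (re a + re b) *\<^sub>R 1 + (im a + im b) *\<^sub>R i"
        using re[of a] re[of b] by (simp add: algebra_simps)
      then show "re (a + b) = re a + re b" using eq by blast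
      fix c
      have "c *\<^sub>R a = c *\<^sub>R (re a *\<^sub>R 1 + im a *\<^sub>R i)" using re[of a] by simp
      then have "c *\<^sub>R a = (c * re a) *\<^sub>R 1 + (c * im a) *\<^sub>R i" by (simp add: scaleR_right_distrib)
      then show "re (c *\<^sub>R a) = c *\<^sub>R re a" using eq by (metis real_scaleR_def)
    qed
    moreover have "\<bar>re z\<bar> \<le> norm z" for z
      using re[of z] 2(3) by (metis real_sqrt_sum_squares_ge1 real_sqrt_abs real_sqrt_le_mono le_add_same_cancel1 zero_le_power2)
    moreover have "re 1 = 1" "re i = 0" using eq[of 1 1 0] eq[of i 0 1] by auto
    moreover have "re (i * z) = - im z" for z
    proof -
      have "i * z = i * (re z *\<^sub>R 1 + im z *\<^sub>R i)" using re[of z] by simp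
      also have "\<dots> = (- im z) *\<^sub>R 1 + re z *\<^sub>R i" using 2(1) by (simp add: algebra_simps)
      finally show ?thesis using eq by blast
    qed
    ultimately show ?thesis unfolding is_real_part_def using re 2(1) by (intro exI[of _ re] exI[of _ i]) auto
  qed
qed

definition real_part_and_unit :: "('k::real_or_complex_field \<Rightarrow> real) \<times> 'k"
  where "real_part_and_unit = (SOME q. is_real_part (fst q) (snd q))"

definition re_part :: "'k::real_or_complex_field \<Rightarrow> real"
  where "re_part = fst real_part_and_unit"

definition im_unit :: "'k::real_or_complex_field"
  where "im_unit = snd real_part_and_unit"

lemma is_real_part_re_part: "is_real_part (re_part :: 'k::real_or_complex_field \<Rightarrow> real) im_unit"
proof -
  have "\<exists>q :: ('k \<Rightarrow> real) \<times> 'k. is_real_part (fst q) (snd q)"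
    using real_part_exists[where 'k = 'k] by auto
  from someI_ex[OF this] show ?thesis
    unfolding re_part_def im_unit_def real_part_and_unit_def .
qed

lemma linear_re_part: "linear (re_part :: 'k::real_or_complex_field \<Rightarrow> real)"
  and re_part_1: "re_part (1::'k) = 1"
  and abs_re_part_le: "\<bar>re_part (z::'k)\<bar> \<le> norm z"
  and re_part_im_unit: "re_part (im_unit::'k) = 0"
  and im_unit_cases: "im_unit = (0::'k) \<or> im_unit * im_unit = - (1::'k)"
  and re_part_decomp: "(z::'k) = re_part z *\<^sub>R 1 - re_part (im_unit * z) *\<^sub>R im_unit"
  using is_real_part_re_part[where 'k = 'k] unfolding is_real_part_def by blast+

lemma re_part_of_real: "re_part (of_real r :: 'k::real_or_complex_field) = r"
  using linear_scale[OF linear_re_part, of r "1::'k"] by (simp add: re_part_1 of_real_def)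

lemma bounded_linear_re_part: "bounded_linear (re_part :: 'k::real_or_complex_field \<Rightarrow> real)"
  using abs_re_part_le
  by (intro bounded_linear_intro[where K = 1]) (auto simp: linear_add[OF linear_re_part] linear_scale[OF linear_re_part])

lemma re_part_eqI:
  fixes z w :: "'k::real_or_complex_field"
  assumes "\<And>c. re_part (c * z) = re_part (c * w)"
  shows "z = w"
  using re_part_decomp[of z] re_part_decomp[of w] assms[of 1] assms[of im_unit] by simp

lemma tendsto_re_partI:
  fixes z :: "'i \<Rightarrow> 'k::real_or_complex_field"
  assumes "\<And>c. ((\<lambda>n. re_part (c * z n)) \<longlongrightarrow> re_part (c * w)) F"
  shows "(z \<longlongrightarrow> w) F"
proof -
  have "((\<lambda>n. re_part (1 * z n) *\<^sub>R 1 - re_part (im_unit * z n) *\<^sub>R im_unit) \<longlongrightarrow>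
      re_part (1 * w) *\<^sub>R (1::'k) - re_part (im_unit * w) *\<^sub>R im_unit) F"
    by (intro tendsto_intros assms)
  then show ?thesis by (simp flip: re_part_decomp)
qed

text \<open>
  The type class gives completeness and second countability, but not local compactness; it comes from the decomposition
  into two real coordinates.
\<close>

lemma compact_cball_scalars: "compact (cball (0::'k::real_or_complex_field) r)"
proof -
  let ?h = "\<lambda>(a, b). a *\<^sub>R 1 - b *\<^sub>R (im_unit :: 'k)"
  let ?B = "cball (0::real) r \<times> cball (0::real) (norm (im_unit::'k) * r)"
  have "compact (?h ` ?B)"
    by (intro compact_continuous_image compact_Times compact_cball)
      (auto simp: case_prod_beta intro!: continuous_intros)
  moreover have "cball 0 r \<subseteq> ?h ` ?B"
  proof
    fix z :: 'k assume "z \<in> cball 0 r"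
    then have z: "norm z \<le> r" by simp
    have "\<bar>re_part (im_unit * z)\<bar> \<le> norm (im_unit::'k) * norm z"
      using abs_re_part_le[of "im_unit * z"] by (simp add: norm_mult)
    also have "\<dots> \<le> norm (im_unit::'k) * r" using z by (intro mult_left_mono) auto
    finally have "(re_part z, re_part (im_unit * z)) \<in> ?B"
      using z abs_re_part_le[of z] by simp
    then show "z \<in> ?h ` ?B" using re_part_decomp[of z] by (intro image_eqI) auto
  qed
  ultimately have "compact (?h ` ?B \<inter> cball 0 r)" by (intro compact_Int_closed) auto
  then show ?thesis using \<open>cball 0 r \<subseteq> _\<close> by (simp add: Int_absorb1)
qed

section \<open>Functionals over the scalar field\<close>

lemma dual_space_iff: "f \<in> dual_space s \<longleftrightarrow> (\<forall>c x. blinfun_apply f (s c x) = c * blinfun_apply f x)"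
  unfolding dual_space_def bounded_ops_def by simp

lemma dual_space_apply: "f \<in> dual_space s \<Longrightarrow> blinfun_apply f (s c x) = c * blinfun_apply f x"
  by (simp add: dual_space_iff)

lemma subspace_dual_space: "subspace (dual_space s)"
  by (auto intro!: subspaceI simp: dual_space_iff blinfun.add_left blinfun.scaleR_left algebra_simps)

context banach_space_over
begin

lemma scale_scaleR: "scale c (r *\<^sub>R x) = r *\<^sub>R scale c x"
  by (metis scale_left_commute scale_of_real)

lemma bounded_linear_scale_right: "bounded_linear (scale c)"
  by (rule bounded_linear_intro[where K = "norm c"])
    (auto simp: scale_right_distrib scale_scaleR norm_scale)

lemma scale_scaleR_left: "scale (r *\<^sub>R c) x = r *\<^sub>R scale c x"
  by (metis scale_scale scale_of_real scaleR_conv_of_real)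

lemma bounded_bilinear_scale: "bounded_bilinear scale"
proof
  show "\<exists>K. \<forall>c x. norm (scale c x) \<le> norm c * norm x * K"
    by (rule exI[of _ 1]) (simp add: norm_scale)
qed (auto simp: scale_right_distrib scale_left_distrib scale_scaleR scale_scaleR_left)

text \<open>
  Real parts determine the norm, because a value of \<open>f\<close> can be rotated to be real and nonnegative.
\<close>

lemma norm_dual_le:
  assumes f: "f \<in> dual_space scale" and C: "0 \<le> C"
    and le: "\<And>x. re_part (blinfun_apply f x) \<le> C * norm x"
  shows "norm f \<le> C"
proof (rule norm_blinfun_bound[OF C])
  fix x
  show "norm (blinfun_apply f x) \<le> C * norm x"
  proof (cases "blinfun_apply f x = 0")
    case False
    define u where "u = of_real (norm (blinfun_apply f x)) / blinfun_apply f x"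
    have nu: "norm u = 1" using False by (simp add: u_def norm_divide)
    have "blinfun_apply f (scale u x) = of_real (norm (blinfun_apply f x))"
      using False by (simp add: dual_space_apply[OF f] u_def)
    then have "norm (blinfun_apply f x) = re_part (blinfun_apply f (scale u x))"
      by (simp add: re_part_of_real)
    also have "\<dots> \<le> C * norm x" using le[of "scale u x"] nu by (simp add: norm_scale)
    finally show ?thesis .
  qed (use C in simp)
qed

text \<open>
  The familiar formula \<open>f(x) = u(x) - \<iota> u(\<iota> x)\<close>, which for \<open>\<iota> = 0\<close> reduces to \<open>f = u\<close>.
\<close>

lemma dual_functional_of_real_functional:
  assumes u: "linear u" and C: "0 \<le> C" and le: "\<And>x. u x \<le> C * norm x"
  obtains f where "f \<in> dual_space scale" "\<And>x. re_part (blinfun_apply f x) = u x" "norm f \<le> C"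
proof -
  interpret u: linear u by fact
  define F :: "'a \<Rightarrow> 'k" where "F x = u x *\<^sub>R 1 - u (scale im_unit x) *\<^sub>R im_unit" for x
  have absu: "\<bar>u x\<bar> \<le> C * norm x" for x using le[of x] le[of "- x"] by (simp add: u.neg)
  have add: "F (x + y) = F x + F y" for x y
    by (simp add: F_def scale_right_distrib u.add algebra_simps)
  have scR: "F (r *\<^sub>R x) = r *\<^sub>R F x" for r x
    by (simp add: F_def scale_scaleR u.scale algebra_simps)
  have im: "F (scale im_unit x) = im_unit * F x" for x
  proof (cases "im_unit = (0::'k)")
    case False
    then have "im_unit * im_unit = - (1::'k)" using im_unit_cases by blast
    then have "scale im_unit (scale im_unit x) = - x"
      and "im_unit * (u (scale im_unit x) *\<^sub>R im_unit) = - (u (scale im_unit x) *\<^sub>R (1::'k))"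
      by simp_all
    then show ?thesis by (simp add: F_def u.neg right_diff_distrib)
  next
    case True
    then show ?thesis using u.zero by (simp add: F_def)
  qed
  have hom: "F (scale c x) = c * F x" for c x
  proof -
    define a b where "a = re_part c" and "b = - re_part (im_unit * c)"
    have c: "c = a *\<^sub>R 1 + b *\<^sub>R im_unit" using re_part_decomp[of c] by (simp add: a_def b_def)
    have "scale c x = a *\<^sub>R x + b *\<^sub>R scale im_unit x"
      by (simp add: c scale_left_distrib scale_scaleR_left)
    then have "F (scale c x) = a *\<^sub>R F x + b *\<^sub>R (im_unit * F x)" by (simp add: add scR im)
    then show ?thesis by (simp add: c algebra_simps)
  qed
  have re: "re_part (F x) = u x" for x
    by (simp add: F_def linear_diff[OF linear_re_part] linear_scale[OF linear_re_part] re_part_1 re_part_im_unit)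
  have bl: "bounded_linear F"
  proof (rule bounded_linear_intro[where K = "C + C * norm (im_unit::'k) * norm (im_unit::'k)"])
    fix x
    have "norm (F x) \<le> \<bar>u x\<bar> + \<bar>u (scale im_unit x)\<bar> * norm (im_unit::'k)"
      unfolding F_def by (rule order_trans[OF norm_triangle_ineq4]) simp
    also have "\<dots> \<le> C * norm x + (C * norm (scale im_unit x)) * norm (im_unit::'k)"
      by (intro add_mono mult_right_mono absu) auto
    finally show "norm (F x) \<le> norm x * (C + C * norm (im_unit::'k) * norm (im_unit::'k))"
      by (simp add: norm_scale algebra_simps)
  qed (auto simp: add scR)
  define f where "f = Blinfun F"
  have f: "blinfun_apply f = F" by (simp add: f_def bounded_linear_Blinfun_apply[OF bl])
  have "f \<in> dual_space scale" by (simp add: dual_space_iff f hom)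
  moreover have "re_part (blinfun_apply f x) = u x" for x by (simp add: f re)
  ultimately show thesis using norm_dual_le[OF _ C, of f] le that by metis
qed

text \<open>
  Taking real parts identifies the dual over \<open>\<bbbK>\<close> isometrically with the real dual, so a real functional
  that is extreme below the norm comes from an extreme point of the dual ball over \<open>\<bbbK>\<close>.
\<close>

lemma extreme_norming_functional:
  obtains \<phi> where "\<phi> \<in> dual_space scale" "norm \<phi> \<le> 1" "norm w \<le> norm (blinfun_apply \<phi> w)"
    "\<And>g. g \<in> dual_space scale \<Longrightarrow> norm (\<phi> + g) \<le> 1 \<Longrightarrow> norm (\<phi> - g) \<le> 1 \<Longrightarrow> g = 0"
proof -
  obtain u where u: "linear u" "\<And>x. u x \<le> norm x" "u w = norm w"
    and ext: "\<And>g. linear g \<Longrightarrow> (\<And>x. g x \<le> norm x) \<Longrightarrow> (\<And>x. 2 * u x - g x \<le> norm x) \<Longrightarrow> g = u"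
    by (rule Hahn_Banach_extreme[of norm w]) (auto intro: norm_triangle_ineq)
  obtain \<phi> where \<phi>: "\<phi> \<in> dual_space scale" "\<And>x. re_part (blinfun_apply \<phi> x) = u x" "norm \<phi> \<le> 1"
    using dual_functional_of_real_functional[OF u(1), of 1] u(2) by auto
  show thesis
  proof (rule that[OF \<phi>(1,3)])
    show "norm w \<le> norm (blinfun_apply \<phi> w)"
      using abs_re_part_le[of "blinfun_apply \<phi> w"] \<phi>(2) u(3) by simp
    fix g assume g: "g \<in> dual_space scale" "norm (\<phi> + g) \<le> 1" "norm (\<phi> - g) \<le> 1"
    have re_le: "re_part (blinfun_apply f x) \<le> norm x" if "norm f \<le> 1" for f :: "'a \<Rightarrow>\<^sub>L 'k" and x
    proof -
      have "re_part (blinfun_apply f x) \<le> norm (blinfun_apply f x)"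
        using abs_re_part_le[of "blinfun_apply f x"] by simp
      also have "\<dots> \<le> norm f * norm x" by (rule norm_blinfun)
      also have "\<dots> \<le> 1 * norm x" using that by (intro mult_right_mono) auto
      finally show ?thesis by simp
    qed
    have "(\<lambda>x. u x + re_part (blinfun_apply g x)) = u"
    proof (rule ext)
      show "linear (\<lambda>x. u x + re_part (blinfun_apply g x))"
        using u(1) linear_compose[OF bounded_linear.linear[OF blinfun.bounded_linear_right] linear_re_part, of g]
        by (simp add: linear_compose_add o_def)
      show "u x + re_part (blinfun_apply g x) \<le> norm x" for x
        using re_le[OF g(2), of x] by (simp add: blinfun.add_left linear_add[OF linear_re_part] \<phi>(2))
      show "2 * u x - (u x + re_part (blinfun_apply g x)) \<le> norm x" for x
        using re_le[OF g(3), of x] by (simp add: blinfun.diff_left linear_diff[OF linear_re_part] \<phi>(2))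
    qed
    then have "re_part (blinfun_apply g x) = 0" for x by (metis add_cancel_right_right)
    then have "norm g \<le> 0" using g(1) by (intro norm_dual_le) auto
    then show "g = 0" by simp
  qed
qed

lemma dual_separates_points:
  assumes "\<And>f. f \<in> dual_space scale \<Longrightarrow> blinfun_apply f x = blinfun_apply f y"
  shows "x = y"
proof -
  obtain \<phi> where "\<phi> \<in> dual_space scale" "norm (x - y) \<le> norm (blinfun_apply \<phi> (x - y))"
    using extreme_norming_functional[of "x - y"] by blast
  with assms show ?thesis by (simp add: blinfun.diff_right)
qed

end

section \<open>Extreme functionals on a predual of an \<open>L\<^sub>1\<close> space\<close>

definition scale_functional :: "'k::real_or_complex_field \<Rightarrow> ('a::banach \<Rightarrow>\<^sub>L 'k) \<Rightarrow> ('a \<Rightarrow>\<^sub>L 'k)"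
  where "scale_functional c f = Blinfun (\<lambda>x. c * blinfun_apply f x)"

lemma scale_functional_apply [simp]:
  "blinfun_apply (scale_functional c f) x = c * blinfun_apply f x"
proof -
  have "bounded_linear (\<lambda>x. c * blinfun_apply f x)"
    by (intro bounded_linear_compose[OF bounded_linear_mult_right] blinfun.bounded_linear_right)
  then show ?thesis by (simp add: scale_functional_def bounded_linear_Blinfun_apply)
qed

lemma scale_functional_in_dual: "f \<in> dual_space s \<Longrightarrow> scale_functional c f \<in> dual_space s"
  by (simp add: dual_space_iff)

definition functional_on_dual ::
  "('k::real_or_complex_field \<Rightarrow> 'a::banach \<Rightarrow> 'a) \<Rightarrow> (('a \<Rightarrow>\<^sub>L 'k) \<Rightarrow> 'k) \<Rightarrow> bool"
  where "functional_on_dual s F \<longleftrightarrow>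
    (\<forall>f\<in>dual_space s. \<forall>g\<in>dual_space s. F (f + g) = F f + F g) \<and>
    (\<forall>c. \<forall>f\<in>dual_space s. F (scale_functional c f) = c * F f)"

text \<open>
  The map \<open>f \<mapsto> \<alpha>(f) \<phi>\<close> is the L-projection of the dual onto the line spanned by \<open>\<phi>\<close>; equivalently, the kernel
  of \<open>\<phi>\<close> is an M-ideal.
\<close>

definition L_summand_coefficient ::
  "('k::real_or_complex_field \<Rightarrow> 'a::banach \<Rightarrow> 'a) \<Rightarrow> ('a \<Rightarrow>\<^sub>L 'k) \<Rightarrow> (('a \<Rightarrow>\<^sub>L 'k) \<Rightarrow> 'k) \<Rightarrow> bool"
  where "L_summand_coefficient s \<phi> \<alpha> \<longleftrightarrow>
    functional_on_dual s \<alpha> \<and> \<alpha> \<phi> = 1 \<and>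
    (\<forall>f\<in>dual_space s. norm f = norm (\<alpha> f) + norm (f - scale_functional (\<alpha> f) \<phi>))"

text \<open>
  The isometry from \<open>L\<^sub>1(\<mu>)\<close> onto the dual, composed with the passage from integrable functions to their classes.
\<close>

locale dual_is_L1 = banach_space_over s
  for s :: "'k::real_or_complex_field \<Rightarrow> 'b::banach \<Rightarrow> 'b" +
  fixes \<mu> :: "'m measure" and I :: "('m \<Rightarrow> 'k) \<Rightarrow> ('b \<Rightarrow>\<^sub>L 'k)"
  assumes I_dual: "integrable \<mu> f \<Longrightarrow> I f \<in> dual_space s"
    and I_surj: "\<psi> \<in> dual_space s \<Longrightarrow> \<exists>f. integrable \<mu> f \<and> I f = \<psi>"
    and I_add: "integrable \<mu> f \<Longrightarrow> integrable \<mu> g \<Longrightarrow> I (\<lambda>t. f t + g t) = I f + I g"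
    and I_mult: "integrable \<mu> f \<Longrightarrow> I (\<lambda>t. c * f t) = scale_functional c (I f)"
    and norm_I: "integrable \<mu> f \<Longrightarrow> norm (I f) = (\<integral>t. norm (f t) \<partial>\<mu>)"
begin

lemma I_diff:
  assumes "integrable \<mu> f" "integrable \<mu> g"
  shows "I (\<lambda>t. f t - g t) = I f - I g"
proof -
  have "I (\<lambda>t. f t + (-1) * g t) = I f + scale_functional (-1) (I g)"
    using I_add[OF assms(1) integrable_mult_right[OF assms(2), of "-1"]] I_mult[OF assms(2), of "-1"]
    by (simp only:)
  also have "scale_functional (-1) (I g) = - I g"
    by (rule blinfun_eqI) (simp add: blinfun.minus_left)
  finally show ?thesis by simp
qed

lemma I_eq_imp_AE:
  assumes fg: "integrable \<mu> f" "integrable \<mu> g" and "I f = I g"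
  shows "AE t in \<mu>. f t = g t"
proof -
  have "(\<integral>t. norm (f t - g t) \<partial>\<mu>) = 0"
    using I_diff[OF fg] norm_I[of "\<lambda>t. f t - g t"] fg assms(3) by simp
  then show ?thesis
    using fg by (subst (asm) integral_nonneg_eq_0_iff_AE) (auto intro!: integrable_norm)
qed

text \<open>
  A density that charges both \<open>D\<close> and its complement is a midpoint of two others in the unit ball of \<open>L\<^sub>1(\<mu>)\<close>.
\<close>

lemma extreme_density_zero_one:
  assumes h: "integrable \<mu> h" and nh: "(\<integral>t. norm (h t) \<partial>\<mu>) = 1"
    and ext: "\<And>g. g \<in> dual_space s \<Longrightarrow> norm (I h + g) \<le> 1 \<Longrightarrow> norm (I h - g) \<le> 1 \<Longrightarrow> g = 0"
    and D: "D \<in> sets \<mu>"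
  shows "(\<integral>t. indicator D t * norm (h t) \<partial>\<mu>) \<in> {0, 1}"
proof -
  have inh: "integrable \<mu> (\<lambda>t. norm (h t))" using h by (rule integrable_norm)
  have inD: "integrable \<mu> (\<lambda>t. indicator D t * norm (h t))"
    using integrable_mult_indicator[OF D inh] by simp
  define a where "a = (\<integral>t. indicator D t * norm (h t) \<partial>\<mu>)"
  have a0: "a \<ge> 0" unfolding a_def by (intro integral_nonneg_AE) (auto simp: indicator_def)
  have a1: "a \<le> 1" unfolding a_def nh[symmetric]
    by (intro integral_mono inD inh) (auto simp: indicator_def)
  \<comment> \<open>Moving mass between \<open>D\<close> and its complement, in the ratio that keeps both norms equal to 1.\<close>
  define w where "w t = (indicator D t - a :: real)" for t
  have iw: "integrable \<mu> (\<lambda>t. w t * norm (h t))"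
    unfolding w_def left_diff_distrib using inD inh by auto
  have iu: "integrable \<mu> (\<lambda>t. of_real (w t) * h t)"
  proof -
    have "integrable \<mu> (\<lambda>t. indicator D t *\<^sub>R h t - a *\<^sub>R h t)"
      using integrable_mult_indicator[OF D h] h by auto
    moreover have "of_real (w t) * h t = indicator D t *\<^sub>R h t - a *\<^sub>R h t" for t
      by (simp add: w_def indicator_def scaleR_conv_of_real left_diff_distrib)
    ultimately show ?thesis by (simp only:)
  qed
  have intw: "(\<integral>t. w t * norm (h t) \<partial>\<mu>) = 0"
    unfolding w_def left_diff_distrib using inD inh by (simp add: a_def[symmetric] nh)
  have n: "norm (h t + of_real (w t) * h t) = norm (h t) + w t * norm (h t)"
    "norm (h t - of_real (w t) * h t) = norm (h t) - w t * norm (h t)" for t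
  proof -
    have "h t + of_real (w t) * h t = of_real (1 + w t) * h t"
      "h t - of_real (w t) * h t = of_real (1 - w t) * h t" by (simp_all add: algebra_simps)
    moreover have "\<bar>1 + w t\<bar> = 1 + w t" "\<bar>1 - w t\<bar> = 1 - w t"
      using a0 a1 by (auto simp: w_def indicator_def)
    ultimately show "norm (h t + of_real (w t) * h t) = norm (h t) + w t * norm (h t)"
      "norm (h t - of_real (w t) * h t) = norm (h t) - w t * norm (h t)"
      by (simp_all only: norm_mult norm_of_real) (simp_all add: algebra_simps)
  qed
  have "norm (I h + I (\<lambda>t. of_real (w t) * h t)) \<le> 1"
    using h iu inh iw intw nh by (simp add: I_add[symmetric] norm_I n)
  moreover have "norm (I h - I (\<lambda>t. of_real (w t) * h t)) \<le> 1"
    using h iu inh iw intw nh by (simp add: I_diff[symmetric] norm_I n)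
  ultimately have "I (\<lambda>t. of_real (w t) * h t) = 0" using ext I_dual[OF iu] by blast
  then have "0 = (\<integral>t. norm (of_real (w t) * h t) \<partial>\<mu>)" using norm_I[OF iu] by simp
  also have "\<dots> = (\<integral>t. (1 - 2 * a) * (indicator D t * norm (h t)) + a * norm (h t) \<partial>\<mu>)"
  proof (rule Bochner_Integration.integral_cong[OF refl])
    fix t
    have "\<bar>w t\<bar> = (1 - 2 * a) * indicator D t + a"
      using a0 a1 by (auto simp: w_def indicator_def)
    then show "norm (of_real (w t) * h t) = (1 - 2 * a) * (indicator D t * norm (h t)) + a * norm (h t)"
      by (simp only: norm_mult norm_of_real) (simp add: algebra_simps)
  qed
  also have "\<dots> = (1 - 2 * a) * a + a"
    using inD inh by (simp add: a_def[symmetric] nh)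
  finally have "2 * a * (1 - a) = 0" by (simp add: algebra_simps)
  then show ?thesis unfolding a_def[symmetric] by simp
qed

text \<open>
  Under the probability measure with density \<open>\<bar>h\<bar>\<close> all sets have measure 0 or 1, so \<open>g\<close> lies almost surely on one side
  of its mean and hence equals the mean.
\<close>

lemma real_constant_on_extreme_density:
  fixes h :: "'m \<Rightarrow> 'k" and g :: "'m \<Rightarrow> real"
  assumes h: "integrable \<mu> h" and nh: "(\<integral>t. norm (h t) \<partial>\<mu>) = 1"
    and zo: "\<And>D. D \<in> sets \<mu> \<Longrightarrow> (\<integral>t. indicator D t * norm (h t) \<partial>\<mu>) \<in> {0, 1}"
    and g [measurable]: "g \<in> borel_measurable \<mu>"
    and gh: "integrable \<mu> (\<lambda>t. g t * norm (h t))"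
  shows "AE t in \<mu>. h t \<noteq> 0 \<longrightarrow> g t = (\<integral>t. g t * norm (h t) \<partial>\<mu>)"
proof -
  have [measurable]: "h \<in> borel_measurable \<mu>" using h by auto
  have inh: "integrable \<mu> (\<lambda>t. norm (h t))" using h by (rule integrable_norm)
  define c where "c = (\<integral>t. g t * norm (h t) \<partial>\<mu>)"
  define D where "D = {t \<in> space \<mu>. g t > c}"
  have D: "D \<in> sets \<mu>" unfolding D_def by measurable
  have inD: "integrable \<mu> (\<lambda>t. indicator D t * norm (h t))"
    using integrable_mult_indicator[OF D inh] by simp
  have ig: "integrable \<mu> (\<lambda>t. (g t - c) * norm (h t))"
    unfolding left_diff_distrib using gh inh by auto
  have zero: "(\<integral>t. (g t - c) * norm (h t) \<partial>\<mu>) = 0"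
    unfolding left_diff_distrib using gh inh by (simp add: c_def[symmetric] nh)
  from zo[OF D] consider "(\<integral>t. indicator D t * norm (h t) \<partial>\<mu>) = 0"
    | "(\<integral>t. indicator D t * norm (h t) \<partial>\<mu>) = 1" by blast
  then have "AE t in \<mu>. (g t - c) * norm (h t) = 0"
  proof cases
    case 1
    then have "AE t in \<mu>. indicator D t * norm (h t) = 0"
      using inD by (subst (asm) integral_nonneg_eq_0_iff_AE) auto
    then have le: "AE t in \<mu>. 0 \<le> - ((g t - c) * norm (h t))"
      using AE_space by eventually_elim (auto simp: D_def indicator_def mult_le_0_iff split: if_splits)
    have "(\<integral>t. - ((g t - c) * norm (h t)) \<partial>\<mu>) = 0" using zero by simp
    then show ?thesis using integral_nonneg_eq_0_iff_AE[OF integrable_minus[OF ig] le] by simp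
  next
    case 2
    have "(\<integral>t. (1 - indicator D t) * norm (h t) \<partial>\<mu>) = 0"
      using 2 inD inh nh by (simp add: left_diff_distrib)
    moreover have "integrable \<mu> (\<lambda>t. (1 - indicator D t) * norm (h t))"
      using inD inh by (simp add: left_diff_distrib)
    ultimately have "AE t in \<mu>. (1 - indicator D t) * norm (h t) = 0"
      by (subst (asm) integral_nonneg_eq_0_iff_AE) (auto simp: indicator_def)
    then have le: "AE t in \<mu>. 0 \<le> (g t - c) * norm (h t)"
      using AE_space by eventually_elim (auto simp: D_def indicator_def split: if_splits)
    then show ?thesis using integral_nonneg_eq_0_iff_AE[OF ig le] zero by simp
  qed
  then show ?thesis unfolding c_def[symmetric] by eventually_elim auto
qed

text \<open>
  Let \<open>h\<close> represent \<open>\<phi>\<close>. Where \<open>h\<close> does not vanish, every integrable \<open>f\<close> is a constant multiple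
  \<open>c h\<close>, because \<open>f / h\<close> is almost surely constant for the density \<open>\<bar>h\<bar>\<close>. So \<open>f\<close> is the sum of \<open>c h\<close> and a function with
  disjoint support, and norms in \<open>L\<^sub>1(\<mu>)\<close> add up on disjoint supports. Writing \<open>c\<close> as an integral shows that it
  depends linearly on \<open>f\<close>.
\<close>

theorem extreme_functional_L_summand:
  assumes \<phi>: "\<phi> \<in> dual_space s" "norm \<phi> \<le> 1" "\<phi> \<noteq> 0"
    and ext: "\<And>g. g \<in> dual_space s \<Longrightarrow> norm (\<phi> + g) \<le> 1 \<Longrightarrow> norm (\<phi> - g) \<le> 1 \<Longrightarrow> g = 0"
  obtains \<alpha> where "L_summand_coefficient s \<phi> \<alpha>"
proof -
  have n1: "norm \<phi> = 1"
  proof (rule ccontr)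
    assume "norm \<phi> \<noteq> 1"
    \<comment> \<open>A functional inside the open ball is the midpoint of two multiples of itself.\<close>
    define t where "t = 1 - norm \<phi>"
    have t: "0 < t" "t < 1" using \<phi> \<open>norm \<phi> \<noteq> 1\<close> by (auto simp: t_def)
    have sq: "(1 + t) * norm \<phi> \<le> 1" using zero_le_square[of t] by (simp add: t_def algebra_simps)
    have "norm (\<phi> + t *\<^sub>R \<phi>) = (1 + t) * norm \<phi>"
      using t norm_scaleR[of "1 + t" \<phi>] by (simp add: scaleR_left_distrib)
    moreover have "norm (\<phi> - t *\<^sub>R \<phi>) = (1 - t) * norm \<phi>"
      using t norm_scaleR[of "1 - t" \<phi>] by (simp add: scaleR_left_diff_distrib)
    moreover have "(1 - t) * norm \<phi> \<le> (1 + t) * norm \<phi>" using t by (intro mult_right_mono) auto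
    moreover have "t *\<^sub>R \<phi> \<in> dual_space s" using \<phi>(1) subspace_dual_space Real_Vector_Spaces.subspace_scale by blast
    ultimately have "t *\<^sub>R \<phi> = 0" using ext[of "t *\<^sub>R \<phi>"] sq by simp
    then show False using t \<phi>(3) by simp
  qed
  obtain h where h: "integrable \<mu> h" "I h = \<phi>" using I_surj[OF \<phi>(1)] by blast
  have [measurable]: "h \<in> borel_measurable \<mu>" using h by auto
  have nh: "(\<integral>t. norm (h t) \<partial>\<mu>) = 1" using norm_I[OF h(1)] h(2) n1 by simp
  have zo: "(\<integral>t. indicator D t * norm (h t) \<partial>\<mu>) \<in> {0, 1}" if "D \<in> sets \<mu>" for D
    using extreme_density_zero_one[OF h(1) nh _ that] ext h(2) by blast
  \<comment> \<open>The mean of \<open>f / h\<close> for the density \<open>\<bar>h\<bar>\<close>; division by zero contributes nothing.\<close>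
  define coef where "coef f = (\<integral>t. norm (h t) *\<^sub>R (f t / h t) \<partial>\<mu>)" for f
  have icoef: "integrable \<mu> (\<lambda>t. norm (h t) *\<^sub>R (f t / h t))" if f: "integrable \<mu> f" for f
  proof (rule Bochner_Integration.integrable_bound[OF f])
    have [measurable]: "f \<in> borel_measurable \<mu>" using f by auto
    show "(\<lambda>t. norm (h t) *\<^sub>R (f t / h t)) \<in> borel_measurable \<mu>" by measurable
    show "AE t in \<mu>. norm (norm (h t) *\<^sub>R (f t / h t)) \<le> norm (f t)"
      by (intro AE_I2) (simp add: norm_divide)
  qed
  have const: "AE t in \<mu>. h t \<noteq> 0 \<longrightarrow> f t = coef f * h t" if f: "integrable \<mu> f" for f
  proof -
    have [measurable]: "f \<in> borel_measurable \<mu>" using f by auto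
    have [measurable]: "(re_part :: 'k \<Rightarrow> real) \<in> borel_measurable borel"
      by (intro borel_measurable_continuous_onI linear_continuous_on bounded_linear_re_part)
    have bl: "bounded_linear (\<lambda>z::'k. re_part (b * z))" for b
      by (intro bounded_linear_compose[OF bounded_linear_re_part] bounded_linear_mult_right)
    have AEb: "AE t in \<mu>. h t \<noteq> 0 \<longrightarrow> re_part (b * (f t / h t)) = re_part (b * coef f)" for b
    proof -
      have eq: "re_part (b * (norm (h t) *\<^sub>R (f t / h t))) = re_part (b * (f t / h t)) * norm (h t)" for t
        using linear_scale[OF linear_re_part, of "norm (h t)" "b * (f t / h t)"] by (simp add: mult.commute)
      have i: "integrable \<mu> (\<lambda>t. re_part (b * (f t / h t)) * norm (h t))"
        using integrable_bounded_linear[OF bl[of b] icoef[OF f]] unfolding eq .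
      have "(\<integral>t. re_part (b * (f t / h t)) * norm (h t) \<partial>\<mu>) = re_part (b * coef f)"
        using integral_bounded_linear[OF bl[of b] icoef[OF f]] unfolding eq coef_def .
      moreover have m: "(\<lambda>t. re_part (b * (f t / h t))) \<in> borel_measurable \<mu>" by measurable
      ultimately show ?thesis using real_constant_on_extreme_density[OF h(1) nh zo m i] by simp
    qed
    from AEb[of 1] AEb[of im_unit] show ?thesis
    proof eventually_elim
      case (elim t)
      show ?case
      proof
        assume ht: "h t \<noteq> 0"
        then have "f t / h t = coef f"
          using re_part_decomp[of "f t / h t"] re_part_decomp[of "coef f"] elim by simp
        then show "f t = coef f * h t" using ht by (simp add: field_simps)
      qed
    qed
  qed
  define rep where "rep \<psi> = (SOME f. integrable \<mu> f \<and> I f = \<psi>)" for \<psi>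
  have rep: "integrable \<mu> (rep \<psi>)" "I (rep \<psi>) = \<psi>" if "\<psi> \<in> dual_space s" for \<psi>
    using someI_ex[OF I_surj[OF that]] unfolding rep_def by auto
  define \<alpha> where "\<alpha> \<psi> = coef (rep \<psi>)" for \<psi>
  have \<alpha>I: "\<alpha> (I f) = coef f" if f: "integrable \<mu> f" for f
  proof -
    have r: "integrable \<mu> (rep (I f))" "I (rep (I f)) = I f" using rep[OF I_dual[OF f]] by auto
    have "AE t in \<mu>. rep (I f) t = f t" by (rule I_eq_imp_AE[OF r(1) f r(2)])
    then have "AE t in \<mu>. norm (h t) *\<^sub>R (rep (I f) t / h t) = norm (h t) *\<^sub>R (f t / h t)"
      by eventually_elim simp
    then show ?thesis unfolding \<alpha>_def coef_def
      using icoef[OF f] icoef[OF r(1)] by (intro integral_cong_AE) auto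
  qed
  have "\<alpha> (f + g) = \<alpha> f + \<alpha> g" if "f \<in> dual_space s" "g \<in> dual_space s" for f g
  proof -
    have "\<alpha> (I (\<lambda>t. rep f t + rep g t)) = coef (rep f) + coef (rep g)"
      using icoef rep(1) that by (subst \<alpha>I) (auto simp: coef_def add_divide_distrib scaleR_right_distrib)
    then show ?thesis using rep that by (simp add: I_add \<alpha>_def)
  qed
  moreover have "\<alpha> (scale_functional c f) = c * \<alpha> f" if "f \<in> dual_space s" for c f
  proof -
    have "coef (\<lambda>t. c * rep f t) = (\<integral>t. c * (norm (h t) *\<^sub>R (rep f t / h t)) \<partial>\<mu>)"
      unfolding coef_def by (rule Bochner_Integration.integral_cong) (rule refl, simp)
    also have "\<dots> = c * coef (rep f)" unfolding coef_def by (rule integral_mult_right_zero)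
    finally have "\<alpha> (I (\<lambda>t. c * rep f t)) = c * coef (rep f)"
      using rep(1)[OF that] by (subst \<alpha>I) auto
    then show ?thesis using rep that by (simp add: I_mult \<alpha>_def)
  qed
  moreover have "\<alpha> \<phi> = 1"
  proof -
    have "\<alpha> \<phi> = coef h" using \<alpha>I[OF h(1)] h(2) by simp
    also have "\<dots> = (\<integral>t. of_real (norm (h t)) \<partial>\<mu>)"
      unfolding coef_def by (intro Bochner_Integration.integral_cong) (auto simp: scaleR_conv_of_real)
    also have "\<dots> = 1" using h(1) nh by (simp add: integral_of_real)
    finally show ?thesis .
  qed
  moreover have "norm f = norm (\<alpha> f) + norm (f - scale_functional (\<alpha> f) \<phi>)" if f: "f \<in> dual_space s" for f
  proof -
    let ?r = "rep f" and ?c = "\<alpha> f"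
    have r: "integrable \<mu> ?r" "I ?r = f" using rep[OF f] .
    have ch: "integrable \<mu> (\<lambda>t. ?c * h t)" using h(1) by simp
    have "AE t in \<mu>. norm (?r t) = norm ?c * norm (h t) + norm (?r t - ?c * h t)"
      using const[OF r(1)] unfolding \<alpha>_def[symmetric]
      by eventually_elim (auto simp: norm_mult)
    then have "(\<integral>t. norm (?r t) \<partial>\<mu>) = (\<integral>t. norm ?c * norm (h t) + norm (?r t - ?c * h t) \<partial>\<mu>)"
      using r(1) h(1) ch by (intro integral_cong_AE) auto
    also have "\<dots> = norm ?c + (\<integral>t. norm (?r t - ?c * h t) \<partial>\<mu>)"
      using r(1) h(1) ch by (simp add: nh integrable_norm)
    also have "(\<integral>t. norm (?r t - ?c * h t) \<partial>\<mu>) = norm (f - scale_functional ?c \<phi>)"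
      using r ch h by (simp add: norm_I[symmetric] I_diff I_mult)
    finally show ?thesis using norm_I[OF r(1)] r(2) by simp
  qed
  ultimately show thesis
    by (intro that[of \<alpha>]) (simp add: L_summand_coefficient_def functional_on_dual_def)
qed

end

section \<open>A Helly theorem for elements of the bidual\<close>

lemma infdist_lessE:
  assumes "infdist x M < r" "M \<noteq> {}"
  obtains a where "a \<in> M" "dist x a < r"
  using assms by (auto simp: infdist_notempty cINF_less_iff)

lemma infdist_subspace_add:
  fixes M :: "'v::real_normed_vector set"
  assumes M: "subspace M"
  shows "infdist (x + y) M \<le> infdist x M + infdist y M"
proof (rule field_le_epsilon)
  fix e :: real assume "e > 0"
  have ne: "M \<noteq> {}" using subspace_0[OF M] by blast
  obtain a where a: "a \<in> M" "dist x a < infdist x M + e / 2"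
    by (rule infdist_lessE[OF _ ne, of x "infdist x M + e / 2"]) (use \<open>e > 0\<close> in auto)
  obtain b where b: "b \<in> M" "dist y b < infdist y M + e / 2"
    by (rule infdist_lessE[OF _ ne, of y "infdist y M + e / 2"]) (use \<open>e > 0\<close> in auto)
  have "infdist (x + y) M \<le> dist (x + y) (a + b)"
    by (intro infdist_le subspace_add[OF M] a b)
  also have "\<dots> \<le> dist x a + dist y b" by (rule dist_triangle_add)
  finally show "infdist (x + y) M \<le> infdist x M + infdist y M + e" using a b by simp
qed

lemma infdist_subspace_scale:
  fixes M :: "'v::real_normed_vector set"
  assumes M: "subspace M" and t: "0 \<le> t"
  shows "infdist (t *\<^sub>R x) M = t * infdist x M"
proof (cases "t = 0")
  case True
  then show ?thesis using subspace_0[OF M] by simp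
next
  case False
  have ne: "M \<noteq> {}" using subspace_0[OF M] by blast
  have le: "infdist (r *\<^sub>R w) M \<le> r * infdist w M" if r: "r > 0" for r w
  proof -
    have "infdist (r *\<^sub>R w) M / r \<le> dist w a" if a: "a \<in> M" for a
    proof -
      have "infdist (r *\<^sub>R w) M \<le> dist (r *\<^sub>R w) (r *\<^sub>R a)"
        by (intro infdist_le subspace_scale[OF M] a)
      also have "\<dots> = r * dist w a"
        using r norm_scaleR[of r "w - a"] by (simp add: dist_norm scaleR_right_diff_distrib)
      finally show ?thesis using r by (simp add: field_simps)
    qed
    then have "infdist (r *\<^sub>R w) M / r \<le> infdist w M"
      using ne by (auto simp: infdist_notempty intro!: cINF_greatest)
    then show ?thesis using r by (simp add: field_simps)
  qed
  have t: "t > 0" using t False by simp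
  have "t * infdist x M = t * infdist ((1/t) *\<^sub>R (t *\<^sub>R x)) M" using t by simp
  also have "\<dots> \<le> t * ((1/t) * infdist (t *\<^sub>R x) M)"
    using t by (intro mult_left_mono le) auto
  finally show ?thesis using le[OF t, of x] t by simp
qed

text \<open>
  The space \<open>\<ell>\<^sub>\<infinity>\<^sup>m(Y)\<close> with \<open>m\<close> not fixed by a type: sequences supported in the first \<open>m\<close> places,
  as a subspace of the bounded (trivially continuous) functions on \<open>\<nat>\<close>.
\<close>

definition tuple :: "nat \<Rightarrow> (nat \<Rightarrow> 'b::real_normed_vector) \<Rightarrow> (nat \<Rightarrow>\<^sub>C 'b)"
  where "tuple m w = Bcontfun (\<lambda>j. if j < m then w j else 0)"

lemma tuple_apply: "apply_bcontfun (tuple m w) j = (if j < m then w j else 0)"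
proof -
  have "finite (range (\<lambda>j. if j < m then w j else 0))"
    by (rule finite_subset[of _ "insert 0 (w ` {..<m})"]) auto
  then have "(\<lambda>j. if j < m then w j else 0) \<in> bcontfun"
    by (simp add: bcontfun_def finite_imp_bounded)
  then show ?thesis by (simp add: tuple_def Bcontfun_inverse)
qed

lemma norm_tuple_le:
  assumes "0 \<le> C" "\<And>j. j < m \<Longrightarrow> norm (w j) \<le> C"
  shows "norm (tuple m w) \<le> C"
  using assms by (intro norm_bound) (simp add: tuple_apply)

lemma tuple_add: "tuple m (\<lambda>j. v j + w j) = tuple m v + tuple m w"
  by (rule bcontfun_eqI) (simp add: tuple_apply)

lemma tuple_scaleR: "tuple m (\<lambda>j. r *\<^sub>R w j) = r *\<^sub>R tuple m w"
  by (rule bcontfun_eqI) (simp add: tuple_apply)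

lemma tuple_eq_sum: "tuple m w = (\<Sum>j<m. tuple m (\<lambda>i. if i = j then w j else 0))"
proof (rule bcontfun_eqI)
  fix i
  have "apply_bcontfun (\<Sum>j\<in>A. tuple m (\<lambda>i. if i = j then w j else 0)) i =
      (\<Sum>j\<in>A. if i < m \<and> i = j then w j else 0)" if "finite A" for A
    using that by (induction A) (auto simp: tuple_apply)
  then show "apply_bcontfun (tuple m w) i = apply_bcontfun (\<Sum>j<m. tuple m (\<lambda>i. if i = j then w j else 0)) i"
    by (simp add: tuple_apply if_distrib sum.If_cases)
qed

lemma functional_on_dual_sum:
  assumes F: "functional_on_dual s F" and "finite J" "\<And>j. j \<in> J \<Longrightarrow> \<psi> j \<in> dual_space s"
  shows "(\<Sum>j\<in>J. \<psi> j) \<in> dual_space s \<and> F (\<Sum>j\<in>J. \<psi> j) = (\<Sum>j\<in>J. F (\<psi> j))"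
  using assms(2,3)
proof (induction J)
  case empty
  have z: "0 \<in> dual_space s" by (rule Real_Vector_Spaces.subspace_0[OF subspace_dual_space])
  have "F (0 + 0) = F 0 + F 0" using F z unfolding functional_on_dual_def by blast
  then show ?case using z by simp
next
  case (insert a J)
  then show ?case
    using F unfolding functional_on_dual_def
    by (simp add: Real_Vector_Spaces.subspace_add[OF subspace_dual_space])
qed

context banach_space_over
begin

lemma almost_norming:
  assumes f: "f \<in> dual_space scale" and e: "0 < e"
  obtains x where "norm x \<le> 1" "norm f - e \<le> re_part (blinfun_apply f x)"
proof (cases "norm f \<le> e")
  case True
  then show thesis using that[of 0] by (simp add: linear_0[OF linear_re_part])
next
  case False
  have "\<exists>x. (norm f - e) * norm x < re_part (blinfun_apply f x)"
  proof (rule ccontr)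
    assume "\<not> ?thesis"
    then have "norm f \<le> norm f - e" using False by (intro norm_dual_le[OF f]) (auto simp: not_less)
    then show False using e by simp
  qed
  then obtain x where x: "(norm f - e) * norm x < re_part (blinfun_apply f x)" by blast
  then have "x \<noteq> 0" by (auto simp: linear_0[OF linear_re_part])
  then have "norm f - e < re_part (blinfun_apply f x) / norm x" using x by (simp add: field_simps)
  also have "\<dots> = re_part (blinfun_apply f ((1 / norm x) *\<^sub>R x))"
    by (simp add: blinfun.scaleR_right linear_scale[OF linear_re_part])
  finally show thesis using that[of "(1 / norm x) *\<^sub>R x"] \<open>x \<noteq> 0\<close> by simp
qed

text \<open>
  The vector \<open>y\<close> is sought among the solutions of \<open>\<phi>(y) = F(\<phi>)\<close>. These give a coset in \<open>\<ell>\<^sub>\<infinity>\<^sup>m(Y)\<close> of the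
  subspace \<open>M\<close> of all tuples \<open>(c\<^sub>j y)\<close> with \<open>\<phi>(y) = 0\<close>. A functional \<open>\<Psi>\<close> that realizes the distance of the
  coset from 0 is a tuple of functionals \<open>\<psi>\<^sub>j\<close> with \<open>\<Sum> \<parallel>\<psi>\<^sub>j\<parallel> \<le> 1\<close>. As it vanishes on \<open>M\<close>, the sum
  \<open>\<Sum> c\<^sub>j \<psi>\<^sub>j\<close> is a multiple of \<open>\<phi>\<close>, and therefore takes the same value at \<open>y\<^sub>1\<close> and under \<open>F\<close>. So the distance is the
  real part of \<open>\<Sum> (\<psi>\<^sub>j(z\<^sub>j) + c\<^sub>j F(\<psi>\<^sub>j))\<close>, which the hypothesis bounds by 1.
\<close>

lemma Helly_finite:
  fixes z :: "nat \<Rightarrow> 'a" and c :: "nat \<Rightarrow> 'k"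
  assumes F: "functional_on_dual scale F"
    and le: "\<And>j \<psi>. j < m \<Longrightarrow> \<psi> \<in> dual_space scale \<Longrightarrow> norm (blinfun_apply \<psi> (z j) + c j * F \<psi>) \<le> norm \<psi>"
    and \<phi>: "\<phi> \<in> dual_space scale" and e: "0 < e"
  obtains y where "blinfun_apply \<phi> y = F \<phi>" "\<And>j. j < m \<Longrightarrow> norm (z j + scale (c j) y) \<le> 1 + e"
proof -
  have Fscale: "F (scale_functional a f) = a * F f" if "f \<in> dual_space scale" for a f
    using F that unfolding functional_on_dual_def by blast
  \<comment> \<open>Some solution of the equation, with no control of its norm.\<close>
  obtain y1 where y1: "blinfun_apply \<phi> y1 = F \<phi>"
  proof (cases "\<exists>x. blinfun_apply \<phi> x \<noteq> 0")
    case True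
    then obtain x where "blinfun_apply \<phi> x \<noteq> 0" by blast
    then show thesis using that[of "scale (F \<phi> / blinfun_apply \<phi> x) x"] dual_space_apply[OF \<phi>] by simp
  next
    case False
    then have "scale_functional 0 \<phi> = \<phi>" by (intro blinfun_eqI) simp
    then show thesis using that[of 0] Fscale[OF \<phi>, of 0] by simp
  qed
  define M where "M = (\<lambda>y. tuple m (\<lambda>j. scale (c j) y)) ` {y. blinfun_apply \<phi> y = 0}"
  have M: "Real_Vector_Spaces.subspace M"
  proof (rule Real_Vector_Spaces.subspaceI)
    show "0 \<in> M" unfolding M_def
      by (rule image_eqI[of _ _ 0]) (auto intro!: bcontfun_eqI simp: tuple_apply)
    fix v w assume "v \<in> M" "w \<in> M"
    then obtain x y where xy: "blinfun_apply \<phi> x = 0" "blinfun_apply \<phi> y = 0"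
      and vw: "v = tuple m (\<lambda>j. scale (c j) x)" "w = tuple m (\<lambda>j. scale (c j) y)"
      unfolding M_def by blast
    have "v + w = tuple m (\<lambda>j. scale (c j) (x + y))"
      by (simp only: vw scale_right_distrib tuple_add)
    then show "v + w \<in> M" unfolding M_def using xy
      by (intro image_eqI[of _ _ "x + y"]) (auto simp: blinfun.add_right)
  next
    fix r v assume "v \<in> M"
    then obtain x where x: "blinfun_apply \<phi> x = 0" "v = tuple m (\<lambda>j. scale (c j) x)"
      unfolding M_def by blast
    then have "r *\<^sub>R v = tuple m (\<lambda>j. scale (c j) (r *\<^sub>R x))"
      by (simp only: scale_scaleR tuple_scaleR)
    then show "r *\<^sub>R v \<in> M" unfolding M_def using x
      by (intro image_eqI[of _ _ "r *\<^sub>R x"]) (auto simp: blinfun.scaleR_right)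
  qed
  define v where "v = tuple m (\<lambda>j. z j + scale (c j) y1)"
  obtain \<Psi> where \<Psi>: "linear \<Psi>" "\<And>w. \<Psi> w \<le> infdist w M" "\<Psi> v = infdist v M"
    by (rule Hahn_Banach_extreme[of "\<lambda>w. infdist w M" v])
      (auto intro: infdist_subspace_add[OF M] infdist_subspace_scale[OF M])
  have \<Psi>_norm: "\<Psi> w \<le> norm w" for w
    using \<Psi>(2)[of w] infdist_le[OF Real_Vector_Spaces.subspace_0[OF M], of w] by simp
  have \<Psi>M: "\<Psi> w = 0" if w: "w \<in> M" for w
    using \<Psi>(2)[of w] \<Psi>(2)[of "- w"] w Real_Vector_Spaces.subspace_neg[OF M w] linear_neg[OF \<Psi>(1), of w] by simp
  define single where "single j y = tuple m (\<lambda>i. if i = j then y else 0)" for j and y :: 'a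
  have single: "linear (single j)" "norm (single j y) \<le> norm y" for j y
  proof -
    show "linear (single j)"
      by (rule linearI; rule bcontfun_eqI) (auto simp: single_def tuple_apply)
    show "norm (single j y) \<le> norm y" unfolding single_def by (rule norm_tuple_le) auto
  qed
  have "\<exists>f. f \<in> dual_space scale \<and> (\<forall>y. re_part (blinfun_apply f y) = \<Psi> (single j y))" for j
  proof -
    have "\<Psi> (single j y) \<le> 1 * norm y" for y using \<Psi>_norm[of "single j y"] single(2)[of j y] by simp
    then show ?thesis
      by (rule dual_functional_of_real_functional[OF linear_compose[OF single(1)[of j] \<Psi>(1), unfolded o_def] zero_le_one]) blast
  qed
  then obtain \<psi> where \<psi>: "\<And>j. \<psi> j \<in> dual_space scale"
    "\<And>j y. re_part (blinfun_apply (\<psi> j) y) = \<Psi> (single j y)" by metis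
  have \<Psi>_tuple: "\<Psi> (tuple m w) = (\<Sum>j<m. re_part (blinfun_apply (\<psi> j) (w j)))" for w
    by (subst tuple_eq_sum) (simp add: linear_sum[OF \<Psi>(1)] \<psi>(2) single_def)
  have total: "(\<Sum>j<m. norm (\<psi> j)) \<le> 1"
  proof (rule field_le_epsilon)
    fix d :: real assume d: "d > 0"
    define d' where "d' = d / (real m + 1)"
    have d': "d' > 0" "real m * d' \<le> d" using d by (auto simp: d'_def field_simps)
    have "\<forall>j. \<exists>x. norm x \<le> 1 \<and> norm (\<psi> j) - d' \<le> re_part (blinfun_apply (\<psi> j) x)"
      using almost_norming[OF \<psi>(1) d'(1)] by blast
    then obtain w where w: "\<And>j. norm (w j) \<le> 1" "\<And>j. norm (\<psi> j) - d' \<le> re_part (blinfun_apply (\<psi> j) (w j))"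
      by metis
    have "(\<Sum>j<m. norm (\<psi> j)) - real m * d' = (\<Sum>j<m. norm (\<psi> j) - d')" by (simp add: sum_subtractf)
    also have "\<dots> \<le> \<Psi> (tuple m w)" unfolding \<Psi>_tuple by (intro sum_mono w)
    also have "\<dots> \<le> 1" using \<Psi>_norm[of "tuple m w"] norm_tuple_le[of 1 m w] w(1) by fastforce
    finally show "(\<Sum>j<m. norm (\<psi> j)) \<le> 1 + d" using d' by simp
  qed
  \<comment> \<open>The sum of the \<open>c\<^sub>j \<psi>\<^sub>j\<close>, which will turn out to be a multiple of \<open>\<phi>\<close>.\<close>
  define \<theta> where "\<theta> = (\<Sum>j<m. scale_functional (c j) (\<psi> j))"
  have \<theta>: "\<theta> \<in> dual_space scale" "F \<theta> = (\<Sum>j<m. c j * F (\<psi> j))"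
    using functional_on_dual_sum[OF F, of "{..<m}" "\<lambda>j. scale_functional (c j) (\<psi> j)"]
      scale_functional_in_dual[OF \<psi>(1)] Fscale[OF \<psi>(1)] by (auto simp: \<theta>_def)
  have \<theta>_apply: "blinfun_apply \<theta> y = (\<Sum>j<m. c j * blinfun_apply (\<psi> j) y)" for y
    by (simp add: \<theta>_def blinfun.sum_left)
  have \<theta>_ker: "blinfun_apply \<theta> y = 0" if y: "blinfun_apply \<phi> y = 0" for y
  proof (rule re_part_eqI)
    fix b
    have "re_part (b * blinfun_apply \<theta> y) = re_part (\<Sum>j<m. c j * blinfun_apply (\<psi> j) (scale b y))"
      by (simp only: \<theta>_apply[symmetric] dual_space_apply[OF \<theta>(1)])
    also have "\<dots> = (\<Sum>j<m. re_part (blinfun_apply (\<psi> j) (scale (c j) (scale b y))))"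
      by (simp only: linear_sum[OF linear_re_part] dual_space_apply[OF \<psi>(1)])
    also have "\<dots> = \<Psi> (tuple m (\<lambda>j. scale (c j) (scale b y)))" by (simp only: \<Psi>_tuple)
    also have "\<dots> = 0"
      by (rule \<Psi>M) (auto simp: M_def dual_space_apply[OF \<phi>] y intro!: image_eqI[of _ _ "scale b y"])
    finally show "re_part (b * blinfun_apply \<theta> y) = re_part (b * 0)"
      by (simp add: linear_0[OF linear_re_part])
  qed
  obtain l where l: "\<theta> = scale_functional l \<phi>"
  proof (cases "\<exists>x. blinfun_apply \<phi> x \<noteq> 0")
    case False
    then have "\<theta> = scale_functional 0 \<phi>" using \<theta>_ker by (intro blinfun_eqI) simp
    then show thesis by (rule that)
  next
    case True
    then obtain x where x: "blinfun_apply \<phi> x \<noteq> 0" by blast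
    have "\<theta> = scale_functional (blinfun_apply \<theta> x / blinfun_apply \<phi> x) \<phi>"
    proof (rule blinfun_eqI)
      fix y
      have "blinfun_apply \<theta> (y - scale (blinfun_apply \<phi> y / blinfun_apply \<phi> x) x) = 0"
        using x by (intro \<theta>_ker) (simp add: blinfun.diff_right dual_space_apply[OF \<phi>])
      then show "blinfun_apply \<theta> y = blinfun_apply (scale_functional (blinfun_apply \<theta> x / blinfun_apply \<phi> x) \<phi>) y"
        by (simp add: blinfun.diff_right dual_space_apply[OF \<theta>(1)])
    qed
    then show thesis by (rule that)
  qed
  have \<theta>y1: "blinfun_apply \<theta> y1 = F \<theta>" using l y1 Fscale[OF \<phi>] by simp
  have "infdist v M = re_part (\<Sum>j<m. blinfun_apply (\<psi> j) (z j) + c j * F (\<psi> j))"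
  proof -
    have "infdist v M = \<Psi> v" using \<Psi>(3) by simp
    also have "\<dots> = re_part (\<Sum>j<m. blinfun_apply (\<psi> j) (z j + scale (c j) y1))"
      unfolding v_def \<Psi>_tuple by (simp add: linear_sum[OF linear_re_part])
    also have "(\<Sum>j<m. blinfun_apply (\<psi> j) (z j + scale (c j) y1)) =
        (\<Sum>j<m. blinfun_apply (\<psi> j) (z j)) + blinfun_apply \<theta> y1"
      by (simp add: blinfun.add_right dual_space_apply[OF \<psi>(1)] sum.distrib \<theta>_apply)
    also have "\<dots> = (\<Sum>j<m. blinfun_apply (\<psi> j) (z j) + c j * F (\<psi> j))"
      by (simp add: \<theta>y1 \<theta>(2) sum.distrib)
    finally show ?thesis .
  qed
  also have "\<dots> \<le> norm (\<Sum>j<m. blinfun_apply (\<psi> j) (z j) + c j * F (\<psi> j))"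
    using abs_re_part_le abs_le_D1 by blast
  also have "\<dots> \<le> (\<Sum>j<m. norm (\<psi> j))"
    by (rule sum_norm_le) (use le \<psi>(1) in auto)
  finally have "infdist v M < 1 + e" using total e by simp
  then obtain w where "w \<in> M" "dist v w < 1 + e"
    using Real_Vector_Spaces.subspace_0[OF M] by (rule_tac infdist_lessE) auto
  then obtain y where y: "blinfun_apply \<phi> y = 0" "norm (v - tuple m (\<lambda>j. scale (c j) y)) < 1 + e"
    unfolding M_def dist_norm by blast
  show thesis
  proof (rule that[of "y1 - y"])
    show "blinfun_apply \<phi> (y1 - y) = F \<phi>" using y1 y by (simp add: blinfun.diff_right)
    fix j assume j: "j < m"
    have "norm (z j + scale (c j) (y1 - y)) = norm (apply_bcontfun (v - tuple m (\<lambda>j. scale (c j) y)) j)"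
      using j by (simp add: v_def tuple_apply scale_right_diff_distrib algebra_simps)
    also have "\<dots> \<le> norm (v - tuple m (\<lambda>j. scale (c j) y))" by (rule norm_bounded)
    finally show "norm (z j + scale (c j) (y1 - y)) \<le> 1 + e" using y(2) by simp
  qed
qed

text \<open>
  Think of \<open>F\<close> as an element of the bidual. If \<open>F\<close> satisfies \<open>\<parallel>z + c F\<parallel> \<le> 1\<close> for all \<open>(z, c) \<in> Z\<close>, then
  some \<open>y \<in> Y\<close> satisfies these inequalities up to \<open>e\<close> and agrees with \<open>F\<close> at \<open>\<phi>\<close>. Inequalities with other
  right-hand sides are covered by rescaling the pairs.
\<close>

theorem Helly_compact:
  assumes F: "functional_on_dual scale F"
    and C: "0 < C" "\<And>\<psi>. \<psi> \<in> dual_space scale \<Longrightarrow> norm (F \<psi>) \<le> C * norm \<psi>"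
    and Z: "Z \<subseteq> Z'" "compact Z'"
    and le: "\<And>z c \<psi>. (z, c) \<in> Z \<Longrightarrow> \<psi> \<in> dual_space scale \<Longrightarrow> norm (blinfun_apply \<psi> z + c * F \<psi>) \<le> norm \<psi>"
    and \<phi>: "\<phi> \<in> dual_space scale" and e: "0 < e"
  obtains y where "blinfun_apply \<phi> y = F \<phi>" "\<And>z c. (z, c) \<in> Z \<Longrightarrow> norm (z + scale c y) \<le> 1 + e"
proof -
  define q where "q = e / 2 / (1 + C * (1 + e))"
  have q: "q > 0" using e C by (simp add: q_def add_pos_pos)
  have qe: "q + q * (C * (1 + e)) = e / 2"
  proof -
    have "1 + C * (1 + e) > 0" using e C by (simp add: add_pos_pos)
    then have "q * (1 + C * (1 + e)) = e / 2" unfolding q_def by (subst nonzero_eq_divide_eq[symmetric]) auto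
    then show ?thesis by (simp add: algebra_simps)
  qed
  have "closure Z \<subseteq> Z'" using Z by (simp add: closure_minimal compact_imp_closed)
  then have "compact (closure Z)"
    using compact_Int_closed[OF Z(2) closed_closure, of Z] by (simp add: Int_absorb1)
  then obtain N where N: "finite N" "N \<subseteq> closure Z" "closure Z \<subseteq> (\<Union>w\<in>N. ball w q)"
  proof (rule compactE_image[of "closure Z" "closure Z" "\<lambda>w. ball w q"])
    show "closure Z \<subseteq> (\<Union>w\<in>closure Z. ball w q)" using q by (auto intro!: bexI)
  qed (use that in auto)
  have le': "norm (blinfun_apply \<psi> (fst w) + snd w * F \<psi>) \<le> norm \<psi>"
    if w: "w \<in> closure Z" and \<psi>: "\<psi> \<in> dual_space scale" for w \<psi>
  proof -
    have "closed {w. norm (blinfun_apply \<psi> (fst w) + snd w * F \<psi>) \<le> norm \<psi>}"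
      by (intro closed_Collect_le continuous_intros)
    moreover have "Z \<subseteq> {w. norm (blinfun_apply \<psi> (fst w) + snd w * F \<psi>) \<le> norm \<psi>}"
      using le \<psi> by auto
    ultimately show ?thesis using closure_minimal w by blast
  qed
  \<comment> \<open>The extra pair bounds the norm of \<open>y\<close> in advance, which the passage from the net to \<open>Z\<close> needs.\<close>
  define N' where "N' = insert (0, of_real (1 / C)) N"
  have "finite N'" using N N'_def by simp
  then obtain h where h: "h ` {..<card N'} = N'"
    using ex_bij_betw_nat_finite[of N'] by (auto simp: bij_betw_def atLeast0LessThan)
  have leN: "norm (blinfun_apply \<psi> (fst w) + snd w * F \<psi>) \<le> norm \<psi>"
    if w: "w \<in> N'" and \<psi>: "\<psi> \<in> dual_space scale" for w \<psi>
  proof (cases "w \<in> N")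
    case True then show ?thesis using le' N(2) \<psi> by blast
  next
    case False
    then have "w = (0, of_real (1 / C))" using w N'_def by simp
    then show ?thesis using C(1) C(2)[OF \<psi>] by (simp add: norm_mult norm_divide field_simps)
  qed
  obtain y where y: "blinfun_apply \<phi> y = F \<phi>"
    and yj: "\<And>j. j < card N' \<Longrightarrow> norm (fst (h j) + scale (snd (h j)) y) \<le> 1 + e / 2"
  proof (rule Helly_finite[OF F _ \<phi>, of "card N'" "\<lambda>j. fst (h j)" "\<lambda>j. snd (h j)" "e / 2"])
    show "norm (blinfun_apply \<psi> (fst (h j)) + snd (h j) * F \<psi>) \<le> norm \<psi>"
      if "j < card N'" "\<psi> \<in> dual_space scale" for j \<psi>
      using leN[of "h j" \<psi>] h that by blast
  qed (use e in auto)
  have yN: "norm (fst w + scale (snd w) y) \<le> 1 + e / 2" if "w \<in> N'" for w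
    using yj h that by (metis imageE lessThan_iff)
  have "norm (scale (of_real (1 / C)) y) \<le> 1 + e / 2"
    using yN[of "(0, of_real (1 / C))"] by (simp add: N'_def)
  then have "norm y \<le> C * (1 + e / 2)" using C(1) by (simp add: norm_scale norm_divide field_simps)
  also have "\<dots> \<le> C * (1 + e)" using C(1) e by (intro mult_left_mono) auto
  finally have ny: "norm y \<le> C * (1 + e)" .
  show thesis
  proof (rule that[OF y])
    fix z c assume "(z, c) \<in> Z"
    then have "(z, c) \<in> (\<Union>w\<in>N. ball w q)" using N(3) closure_subset[of Z] by blast
    then obtain w where w: "w \<in> N" "dist w (z, c) < q" by auto
    have d: "norm (z - fst w) \<le> q" "norm (c - snd w) \<le> q"
      using w(2) dist_fst_le[of w "(z, c)"] dist_snd_le[of w "(z, c)"] by (auto simp: dist_norm norm_minus_commute)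
    have "z + scale c y = (fst w + scale (snd w) y) + ((z - fst w) + scale (c - snd w) y)"
      by (simp add: scale_left_diff_distrib)
    also have "norm \<dots> \<le> norm (fst w + scale (snd w) y) + (norm (z - fst w) + norm (scale (c - snd w) y))"
      by (intro norm_triangle_mono order_refl)
    also have "\<dots> \<le> (1 + e / 2) + (q + q * (C * (1 + e)))"
    proof (intro add_mono d yN)
      show "w \<in> N'" using w by (simp add: N'_def)
      show "norm (scale (c - snd w) y) \<le> q * (C * (1 + e))"
        unfolding norm_scale using d ny q by (intro mult_mono) auto
    qed
    finally show "norm (z + scale c y) \<le> 1 + e" using qe by simp
  qed
qed

end

section \<open>Peaks at an extreme functional\<close>

lemma norm_blinfun_le_on_ball:
  assumes C: "0 \<le> C" and le: "\<And>x. norm x \<le> 1 \<Longrightarrow> norm (blinfun_apply T x) \<le> C"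
  shows "norm T \<le> C"
proof (rule norm_blinfun_bound[OF C])
  fix x
  show "norm (blinfun_apply T x) \<le> C * norm x"
  proof (cases "x = 0")
    case False
    then have "norm (blinfun_apply T ((1 / norm x) *\<^sub>R x)) \<le> C" by (intro le) simp
    then show ?thesis using False by (simp add: blinfun.scaleR_right field_simps)
  qed (use C in simp)
qed

lemma norm_blinfun_on_ball: "norm x \<le> 1 \<Longrightarrow> norm (blinfun_apply T x) \<le> norm T"
  using norm_blinfun[of T x] mult_left_mono[of "norm x" 1 "norm T"] by simp

context banach_space_over
begin

lemma L_summand_coefficient_split:
  assumes \<alpha>: "L_summand_coefficient scale \<phi> \<alpha>" and \<psi>: "\<psi> \<in> dual_space scale"
  shows "\<exists>\<nu>. (\<forall>y. blinfun_apply \<psi> y = \<alpha> \<psi> * blinfun_apply \<phi> y + blinfun_apply \<nu> y) \<and>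
    norm \<psi> = norm (\<alpha> \<psi>) + norm \<nu>"
proof (intro exI conjI allI)
  let ?\<nu> = "\<psi> - scale_functional (\<alpha> \<psi>) \<phi>"
  show "blinfun_apply \<psi> y = \<alpha> \<psi> * blinfun_apply \<phi> y + blinfun_apply ?\<nu> y" for y
    by (simp add: blinfun.diff_left)
  show "norm \<psi> = norm (\<alpha> \<psi>) + norm ?\<nu>"
    using \<alpha> \<psi> unfolding L_summand_coefficient_def by blast
qed

text \<open>
  In the bidual the inequality holds with \<open>\<alpha>\<close> in place of \<open>y\<close> and without \<open>\<eta>\<close>: the vector
  \<open>z - \<phi>(z) \<alpha>\<close> is the component of \<open>z\<close> off the atom, and its sum with \<open>a \<alpha>\<close> has norm
  \<open>max |a| \<parallel>z - \<phi>(z) \<alpha>\<parallel> \<le> \<tau>\<close>. Helly's theorem moves \<open>\<alpha>\<close> into the space.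
\<close>

lemma approximate_peak:
  assumes \<alpha>: "L_summand_coefficient scale \<phi> \<alpha>" and \<phi>: "\<phi> \<in> dual_space scale"
    and K: "compact K" "\<And>z. z \<in> K \<Longrightarrow> norm z \<le> \<tau>" and \<tau>: "0 < \<tau>" and \<eta>: "0 < \<eta>"
  obtains y where "blinfun_apply \<phi> y = 1"
    "\<And>z a. z \<in> K \<Longrightarrow> norm a \<le> \<tau> \<Longrightarrow> norm (z + scale (a - blinfun_apply \<phi> z) y) \<le> \<tau> + \<eta>"
proof -
  define h where "h = (\<lambda>(z, a). ((1/\<tau>) *\<^sub>R z, (1/\<tau>) *\<^sub>R (a - blinfun_apply \<phi> z)))"
  define Z where "Z = h ` (K \<times> cball 0 \<tau>)"
  have cZ: "compact Z" unfolding Z_def h_def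
    by (intro compact_continuous_image compact_Times K compact_cball_scalars)
      (auto simp: case_prod_beta intro!: continuous_intros)
  have F: "functional_on_dual scale \<alpha>" and \<alpha>\<phi>: "\<alpha> \<phi> = 1"
    using \<alpha> unfolding L_summand_coefficient_def by auto
  have bnd: "norm (\<alpha> \<psi>) \<le> 1 * norm \<psi>" if \<psi>: "\<psi> \<in> dual_space scale" for \<psi>
  proof -
    obtain \<nu> where "\<And>y. blinfun_apply \<psi> y = \<alpha> \<psi> * blinfun_apply \<phi> y + blinfun_apply \<nu> y"
      "norm \<psi> = norm (\<alpha> \<psi>) + norm \<nu>" using L_summand_coefficient_split[OF \<alpha> \<psi>] by blast
    then show ?thesis by simp
  qed
  have leZ: "norm (blinfun_apply \<psi> z + c * \<alpha> \<psi>) \<le> norm \<psi>"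
    if zc: "(z, c) \<in> Z" and \<psi>: "\<psi> \<in> dual_space scale" for z c \<psi>
  proof -
    obtain w a where wa: "w \<in> K" "norm a \<le> \<tau>" "z = (1/\<tau>) *\<^sub>R w" "c = (1/\<tau>) *\<^sub>R (a - blinfun_apply \<phi> w)"
      using zc unfolding Z_def h_def by auto
    obtain \<nu> where \<nu>: "\<And>y. blinfun_apply \<psi> y = \<alpha> \<psi> * blinfun_apply \<phi> y + blinfun_apply \<nu> y"
      "norm \<psi> = norm (\<alpha> \<psi>) + norm \<nu>" using L_summand_coefficient_split[OF \<alpha> \<psi>] by blast
    have "blinfun_apply \<psi> z + c * \<alpha> \<psi> = (1/\<tau>) *\<^sub>R (blinfun_apply \<nu> w + a * \<alpha> \<psi>)"
      unfolding wa(3,4) by (simp add: blinfun.scaleR_right \<nu>(1)[of w] algebra_simps)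
    also have "norm \<dots> = (1/\<tau>) * norm (blinfun_apply \<nu> w + a * \<alpha> \<psi>)" using \<tau> by simp
    also have "\<dots> \<le> (1/\<tau>) * (norm \<nu> * \<tau> + \<tau> * norm (\<alpha> \<psi>))"
    proof (rule mult_left_mono)
      have "norm (blinfun_apply \<nu> w) \<le> norm \<nu> * \<tau>"
        using norm_blinfun[of \<nu> w] K(2)[OF wa(1)] mult_left_mono[of "norm w" \<tau> "norm \<nu>"] by simp
      moreover have "norm (a * \<alpha> \<psi>) \<le> \<tau> * norm (\<alpha> \<psi>)"
        unfolding norm_mult using wa(2) by (rule mult_right_mono) simp
      ultimately show "norm (blinfun_apply \<nu> w + a * \<alpha> \<psi>) \<le> norm \<nu> * \<tau> + \<tau> * norm (\<alpha> \<psi>)"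
        by (rule norm_triangle_mono)
    qed (use \<tau> in simp)
    also have "\<dots> = norm \<psi>" using \<tau> \<nu>(2) by (simp add: field_simps)
    finally show ?thesis .
  qed
  have e: "0 < \<eta> / \<tau>" using \<eta> \<tau> by simp
  obtain y where y: "blinfun_apply \<phi> y = \<alpha> \<phi>"
    "\<And>z c. (z, c) \<in> Z \<Longrightarrow> norm (z + scale c y) \<le> 1 + \<eta> / \<tau>"
  proof (rule Helly_compact[OF F zero_less_one bnd order_refl cZ leZ \<phi> e])
    fix y assume "blinfun_apply \<phi> y = \<alpha> \<phi>" "\<And>z c. (z, c) \<in> Z \<Longrightarrow> norm (z + scale c y) \<le> 1 + \<eta> / \<tau>"
    then show thesis by (rule that)
  qed
  show thesis
  proof (rule that)
    show "blinfun_apply \<phi> y = 1" using y \<alpha>\<phi> by simp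
    fix z a assume za: "z \<in> K" "norm (a :: 'k) \<le> \<tau>"
    then have "h (z, a) \<in> Z" unfolding Z_def by (intro imageI) simp
    then have "norm ((1/\<tau>) *\<^sub>R z + scale ((1/\<tau>) *\<^sub>R (a - blinfun_apply \<phi> z)) y) \<le> 1 + \<eta> / \<tau>"
      unfolding h_def by (intro y(2)) simp
    also have "(1/\<tau>) *\<^sub>R z + scale ((1/\<tau>) *\<^sub>R (a - blinfun_apply \<phi> z)) y =
        (1/\<tau>) *\<^sub>R (z + scale (a - blinfun_apply \<phi> z) y)"
      by (simp only: scale_scaleR_left scaleR_right_distrib)
    also have "norm \<dots> = norm (z + scale (a - blinfun_apply \<phi> z) y) / \<tau>"
      using \<tau> by (simp only: norm_scaleR) simp
    finally have "norm (z + scale (a - blinfun_apply \<phi> z) y) / \<tau> \<le> 1 + \<eta> / \<tau>" .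
    then have "norm (z + scale (a - blinfun_apply \<phi> z) y) / \<tau> \<le> (\<tau> + \<eta>) / \<tau>"
      using \<tau> by (simp add: add_divide_distrib)
    then show "norm (z + scale (a - blinfun_apply \<phi> z) y) \<le> \<tau> + \<eta>"
      using \<tau> by (simp only: divide_le_cancel)
  qed
qed

text \<open>
  The vector \<open>p\<close> exceeds the bound \<open>r\<close> by at most \<open>\<eta>\<close>. On the atom there is no excess, since
  \<open>p\<close> has the value \<open>r\<close> there and all \<open>z\<close> vanish. Off the atom, replacing \<open>p\<close> by \<open>(1 - t) p\<close> with \<open>t = \<eta> / d\<close>
  removes the excess:
  \<open>(1 - t) p + z = (1 - t) (p + z) + t z\<close> has norm at most \<open>(1 - t) (r + \<eta>) + t (r - d) \<le> r\<close>. The resulting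
  element of the bidual differs from \<open>p\<close> by at most \<open>t \<parallel>p\<parallel>\<close>, and Helly's theorem, applied to the
  inequalities for \<open>z \<in> K\<close> and for the distance to \<open>p\<close>, moves it into the space.
\<close>

lemma peak_improvement_step:
  assumes \<alpha>: "L_summand_coefficient scale \<phi> \<alpha>" and \<phi>: "\<phi> \<in> dual_space scale"
    and K: "compact K" "0 \<in> K" and K\<phi>: "\<And>z. z \<in> K \<Longrightarrow> blinfun_apply \<phi> z = 0"
    and Kd: "\<And>z. z \<in> K \<Longrightarrow> norm z \<le> r - d" and r: "0 < r" and \<eta>: "0 < \<eta>" "\<eta> \<le> d"
    and p: "blinfun_apply \<phi> p = of_real r" "\<And>z. z \<in> K \<Longrightarrow> norm (p + z) \<le> r + \<eta>"
    and \<eta>': "0 < \<eta>'"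
  obtains p' where "blinfun_apply \<phi> p' = of_real r" "\<And>z. z \<in> K \<Longrightarrow> norm (p' + z) \<le> r + \<eta>'"
    "norm (p' - p) \<le> 2 * (\<eta> / d) * (r + \<eta>)"
proof -
  define t where "t = \<eta> / d"
  define \<sigma> where "\<sigma> = t * (r + \<eta>)"
  have t: "0 < t" "t \<le> 1" "t * d = \<eta>" using \<eta> by (auto simp: t_def field_simps)
  have \<sigma>: "\<sigma> > 0" using t r \<eta> by (simp add: \<sigma>_def)
  have np: "norm p \<le> r + \<eta>" using p(2)[OF K(2)] by simp
  have add: "functional_on_dual scale \<alpha>" and \<alpha>\<phi>: "\<alpha> \<phi> = 1"
    using \<alpha> unfolding L_summand_coefficient_def by auto
  \<comment> \<open>The bidual element that equals \<open>r\<close> on the atom and \<open>(1 - t) p\<close> off it.\<close>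
  define F where "F \<psi> = of_real r * \<alpha> \<psi> + of_real (1 - t) * (blinfun_apply \<psi> p - \<alpha> \<psi> * of_real r)" for \<psi>
  have F: "functional_on_dual scale F"
    using add unfolding functional_on_dual_def F_def
    by (auto simp: blinfun.add_left algebra_simps)
  have F\<phi>: "F \<phi> = of_real r" by (simp add: F_def \<alpha>\<phi> p(1))
  have split: "\<exists>\<nu>. (\<forall>y. blinfun_apply \<psi> y = \<alpha> \<psi> * blinfun_apply \<phi> y + blinfun_apply \<nu> y) \<and>
      norm \<psi> = norm (\<alpha> \<psi>) + norm \<nu> \<and> F \<psi> = of_real r * \<alpha> \<psi> + of_real (1 - t) * blinfun_apply \<nu> p"
    if \<psi>: "\<psi> \<in> dual_space scale" for \<psi>
  proof -
    obtain \<nu> where \<nu>: "\<And>y. blinfun_apply \<psi> y = \<alpha> \<psi> * blinfun_apply \<phi> y + blinfun_apply \<nu> y"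
      "norm \<psi> = norm (\<alpha> \<psi>) + norm \<nu>" using L_summand_coefficient_split[OF \<alpha> \<psi>] by blast
    moreover have "F \<psi> = of_real r * \<alpha> \<psi> + of_real (1 - t) * blinfun_apply \<nu> p"
      unfolding F_def using \<nu>(1)[of p] p(1) by simp
    ultimately show ?thesis by blast
  qed
  define Z where "Z = (\<lambda>z. ((1/r) *\<^sub>R z, of_real (1/r))) ` K \<union> {((1/\<sigma>) *\<^sub>R (- p), of_real (1/\<sigma>) :: 'k)}"
  have cZ: "compact Z" unfolding Z_def
    by (intro compact_Un compact_continuous_image K) (auto intro!: continuous_intros)
  have bnd: "norm (F \<psi>) \<le> (r + norm p) * norm \<psi>" if \<psi>: "\<psi> \<in> dual_space scale" for \<psi>
  proof -
    obtain \<nu> where \<nu>: "norm \<psi> = norm (\<alpha> \<psi>) + norm \<nu>"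
      "F \<psi> = of_real r * \<alpha> \<psi> + of_real (1 - t) * blinfun_apply \<nu> p" using split[OF \<psi>] by blast
    have "norm (F \<psi>) \<le> r * norm (\<alpha> \<psi>) + (1 - t) * norm (blinfun_apply \<nu> p)"
      unfolding \<nu>(2) using r t by (intro norm_triangle_mono) (auto simp: norm_mult simp del: of_real_diff)
    also have "\<dots> \<le> r * norm \<psi> + 1 * (norm \<psi> * norm p)"
    proof (intro add_mono mult_left_mono mult_mono)
      show "norm (blinfun_apply \<nu> p) \<le> norm \<psi> * norm p"
        using norm_blinfun[of \<nu> p] mult_right_mono[of "norm \<nu>" "norm \<psi>" "norm p"] \<nu>(1) by simp
    qed (use r t \<nu>(1) in auto)
    finally show ?thesis by (simp add: algebra_simps)
  qed
  have leZ: "norm (blinfun_apply \<psi> z + c * F \<psi>) \<le> norm \<psi>"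
    if zc: "(z, c) \<in> Z" and \<psi>: "\<psi> \<in> dual_space scale" for z c \<psi>
  proof -
    obtain \<nu> where \<nu>: "\<And>y. blinfun_apply \<psi> y = \<alpha> \<psi> * blinfun_apply \<phi> y + blinfun_apply \<nu> y"
      "norm \<psi> = norm (\<alpha> \<psi>) + norm \<nu>"
      "F \<psi> = of_real r * \<alpha> \<psi> + of_real (1 - t) * blinfun_apply \<nu> p" using split[OF \<psi>] by blast
    consider w where "w \<in> K" "z = (1/r) *\<^sub>R w" "c = of_real (1/r)"
      | "z = (1/\<sigma>) *\<^sub>R (- p)" "c = of_real (1/\<sigma>)"
      using zc unfolding Z_def by auto
    then show ?thesis
    proof cases
      case 1
      have "w + (1 - t) *\<^sub>R p = (1 - t) *\<^sub>R (p + w) + t *\<^sub>R w" by (simp add: algebra_simps)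
      also have "norm \<dots> \<le> (1 - t) * (r + \<eta>) + t * (r - d)"
        using t p(2)[OF 1(1)] Kd[OF 1(1)]
        by (intro norm_triangle_mono) (auto intro!: mult_left_mono)
      also have "\<dots> \<le> r" using t \<eta> by (simp add: algebra_simps)
      finally have le: "norm (w + (1 - t) *\<^sub>R p) \<le> r" .
      have \<nu>p: "blinfun_apply \<nu> (w + (1 - t) *\<^sub>R p) = blinfun_apply \<nu> w + of_real (1 - t) * blinfun_apply \<nu> p"
        by (simp only: blinfun.add_right blinfun.scaleR_right scaleR_conv_of_real)
      have "blinfun_apply \<psi> z + c * F \<psi> = (1/r) *\<^sub>R (blinfun_apply \<nu> (w + (1 - t) *\<^sub>R p) + of_real r * \<alpha> \<psi>)"
        unfolding 1(2,3) \<nu>(3) \<nu>p using r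
        by (simp add: blinfun.scaleR_right \<nu>(1)[of w] K\<phi>[OF 1(1)] scaleR_conv_of_real field_simps
            del: of_real_diff)
      also have "norm \<dots> = (1/r) * norm (blinfun_apply \<nu> (w + (1 - t) *\<^sub>R p) + of_real r * \<alpha> \<psi>)"
        using r by simp
      also have "\<dots> \<le> (1/r) * (norm \<nu> * r + r * norm (\<alpha> \<psi>))"
        using r order_trans[OF norm_blinfun[of \<nu> "w + (1 - t) *\<^sub>R p"] mult_left_mono[OF le norm_ge_zero]]
        by (intro mult_left_mono norm_triangle_mono) (auto simp: norm_mult)
      also have "\<dots> = norm \<psi>" using r \<nu>(2) by (simp add: field_simps)
      finally show ?thesis .
    next
      case 2
      have "blinfun_apply \<psi> z + c * F \<psi> = - ((t / \<sigma>) *\<^sub>R blinfun_apply \<nu> p)"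
        unfolding 2 \<nu>(3)
        by (simp add: blinfun.scaleR_right blinfun.minus_right \<nu>(1)[of p] p(1) scaleR_conv_of_real
            add_divide_distrib diff_divide_distrib left_diff_distrib)
      also have "norm \<dots> = (t / \<sigma>) * norm (blinfun_apply \<nu> p)" using t \<sigma> by simp
      also have "\<dots> \<le> (t / \<sigma>) * (norm \<psi> * (r + \<eta>))"
        using t \<sigma> \<nu>(2) norm_blinfun[of \<nu> p] np r \<eta>
        by (intro mult_left_mono order_trans[OF norm_blinfun[of \<nu> p]] mult_mono) auto
      also have "\<dots> = norm \<psi>" using t r \<eta> by (simp add: \<sigma>_def)
      finally show ?thesis .
    qed
  qed
  \<comment> \<open>Error \<open>\<eta>'\<close> in the inequalities for \<open>z\<close>, and at most a factor 2 in the distance to \<open>p\<close>.\<close>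
  define e where "e = min 1 (\<eta>' / r)"
  have e: "0 < e" using \<eta>' r by (simp add: e_def)
  have C: "0 < r + norm p" using r by (simp add: add_pos_nonneg)
  obtain y where y: "blinfun_apply \<phi> y = F \<phi>"
    "\<And>z c. (z, c) \<in> Z \<Longrightarrow> norm (z + scale c y) \<le> 1 + e"
  proof (rule Helly_compact[OF F C bnd order_refl cZ leZ \<phi> e])
    fix y assume "blinfun_apply \<phi> y = F \<phi>" "\<And>z c. (z, c) \<in> Z \<Longrightarrow> norm (z + scale c y) \<le> 1 + e"
    then show thesis by (rule that)
  qed
  have sc: "(1/q) *\<^sub>R z + scale (of_real (1/q)) y = (1/q) *\<^sub>R (y + z)" for q z
    by (simp only: scale_of_real scaleR_right_distrib add.commute)
  show thesis
  proof (rule that)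
    show "blinfun_apply \<phi> y = of_real r" using y F\<phi> by simp
    show "norm (y + z) \<le> r + \<eta>'" if "z \<in> K" for z
    proof -
      have "norm ((1/r) *\<^sub>R (y + z)) \<le> 1 + e"
        unfolding sc[symmetric] by (rule y(2)) (use that in \<open>auto simp: Z_def\<close>)
      also have "\<dots> \<le> 1 + \<eta>' / r" by (simp add: e_def)
      finally have "norm (y + z) / r \<le> 1 + \<eta>' / r" using r by simp
      then show ?thesis using r by (simp add: field_simps)
    qed
    have "norm ((1/\<sigma>) *\<^sub>R (y + (- p))) \<le> 1 + e"
      unfolding sc[symmetric] by (rule y(2)) (auto simp: Z_def)
    also have "\<dots> \<le> 2" by (simp add: e_def)
    finally have "norm (y - p) / \<sigma> \<le> 2" using \<sigma> by simp
    then have "norm (y - p) \<le> 2 * \<sigma>" using \<sigma> by (simp add: field_simps)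
    then show "norm (y - p) \<le> 2 * (\<eta> / d) * (r + \<eta>)" by (simp add: \<sigma>_def t_def)
  qed
qed

text \<open>
  Iteration of \<open>peak_improvement_step\<close> with errors \<open>\<eta> / 2\<^sup>n\<close>; the steps are summable, and the errors disappear in
  the limit.
\<close>

lemma exact_peak:
  assumes \<alpha>: "L_summand_coefficient scale \<phi> \<alpha>" and \<phi>: "\<phi> \<in> dual_space scale"
    and K: "compact K" "0 \<in> K" and K\<phi>: "\<And>z. z \<in> K \<Longrightarrow> blinfun_apply \<phi> z = 0"
    and Kd: "\<And>z. z \<in> K \<Longrightarrow> norm z \<le> r - d" and r: "0 < r" and \<eta>: "0 < \<eta>" "\<eta> \<le> d"
    and p: "blinfun_apply \<phi> p = of_real r" "\<And>z. z \<in> K \<Longrightarrow> norm (p + z) \<le> r + \<eta>"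
  obtains p' where "blinfun_apply \<phi> p' = of_real r" "\<And>z. z \<in> K \<Longrightarrow> norm (p' + z) \<le> r"
    "norm (p' - p) \<le> 4 * (\<eta> / d) * (r + \<eta>)"
proof -
  define B where "B = 2 * (\<eta> / d) * (r + \<eta>)"
  have B: "0 \<le> B" using \<eta> r by (simp add: B_def)
  \<comment> \<open>The clause for \<open>n = 0\<close> pins the first term of the sequence to \<open>p\<close>.\<close>
  define good where "good n q \<longleftrightarrow> blinfun_apply \<phi> q = of_real r \<and> (\<forall>z\<in>K. norm (q + z) \<le> r + \<eta> * (1/2)^n)
      \<and> (n = 0 \<longrightarrow> q = p)" for n q
  have "\<exists>P. \<forall>n. good n (P n) \<and> norm (P (Suc n) - P n) \<le> B * (1/2)^n"
  proof (rule dependent_nat_choice)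
    show "\<exists>q. good 0 q" using p by (auto simp: good_def)
    fix q n assume q: "good n q"
    have small: "\<eta> * (1/2)^n \<le> \<eta>" using \<eta> by (simp add: mult_left_le power_le_one)
    obtain q' where q': "blinfun_apply \<phi> q' = of_real r" "\<And>z. z \<in> K \<Longrightarrow> norm (q' + z) \<le> r + \<eta> * (1/2)^Suc n"
      "norm (q' - q) \<le> 2 * (\<eta> * (1/2)^n / d) * (r + \<eta> * (1/2)^n)"
      using peak_improvement_step[OF \<alpha> \<phi> K K\<phi> Kd r, of "\<eta> * (1/2)^n" q "\<eta> * (1/2)^Suc n"] q small \<eta>
      unfolding good_def by auto
    have "norm (q' - q) \<le> 2 * (\<eta> * (1/2)^n / d) * (r + \<eta>)"
      by (rule order_trans[OF q'(3)], rule mult_left_mono) (use small \<eta> in auto)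
    moreover have "2 * (\<eta> * x / d) * (r + \<eta>) = B * x" for x
      by (simp add: B_def)
    ultimately have "norm (q' - q) \<le> B * (1/2)^n" by simp
    then show "\<exists>q'. good (Suc n) q' \<and> norm (q' - q) \<le> B * (1/2)^n"
      using q' by (auto simp: good_def)
  qed
  then obtain P where P: "\<And>n. good n (P n)" "\<And>n. norm (P (Suc n) - P n) \<le> B * (1/2)^n" by blast
  have sum: "(\<Sum>i<n. P (Suc i) - P i) = P n - p" for n
    using P(1)[of 0] by (simp add: sum_lessThan_telescope good_def)
  have geo: "summable (\<lambda>n. B * (1/2)^n)" by (intro summable_mult summable_geometric) simp
  have "summable (\<lambda>n. P (Suc n) - P n)"
    by (rule summable_norm_comparison_test[OF _ geo, THEN summable_norm_cancel]) (use P(2) in auto)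
  then have "(\<lambda>n. P n - p) \<longlonglongrightarrow> (\<Sum>n. P (Suc n) - P n)"
    unfolding sum[symmetric] by (rule summable_LIMSEQ)
  then have lim: "P \<longlonglongrightarrow> p + (\<Sum>n. P (Suc n) - P n)" (is "_ \<longlonglongrightarrow> ?q")
    using tendsto_add[OF tendsto_const, of "\<lambda>n. P n - p" _ sequentially p] by simp
  show thesis
  proof (rule that)
    have "(\<lambda>n. blinfun_apply \<phi> (P n)) \<longlonglongrightarrow> blinfun_apply \<phi> ?q" by (intro tendsto_intros lim)
    moreover have "(\<lambda>n. blinfun_apply \<phi> (P n)) = (\<lambda>n. of_real r)" using P(1) by (auto simp: good_def)
    ultimately show "blinfun_apply \<phi> ?q = of_real r" using LIMSEQ_unique[OF _ tendsto_const] by metis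
    show "norm (?q + z) \<le> r" if z: "z \<in> K" for z
    proof (rule LIMSEQ_le)
      show "(\<lambda>n. norm (P n + z)) \<longlonglongrightarrow> norm (?q + z)" by (intro tendsto_intros lim)
      have "(\<lambda>n. r + \<eta> * (1/2)^n) \<longlonglongrightarrow> r + \<eta> * 0"
        by (intro tendsto_intros LIMSEQ_power_zero) simp
      then show "(\<lambda>n. r + \<eta> * (1/2)^n) \<longlonglongrightarrow> r" by simp
      show "\<exists>N. \<forall>n\<ge>N. norm (P n + z) \<le> r + \<eta> * (1/2)^n" using P(1) z by (auto simp: good_def)
    qed
    show "norm (?q - p) \<le> 4 * (\<eta> / d) * (r + \<eta>)"
    proof (rule Lim_bounded)
      show "(\<lambda>n. norm (P n - p)) \<longlonglongrightarrow> norm (?q - p)" by (intro tendsto_intros lim)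
      have "norm (P n - p) \<le> 4 * (\<eta> / d) * (r + \<eta>)" for n
      proof -
        have "norm (P n - p) \<le> (\<Sum>i<n. B * (1/2)^i)"
          unfolding sum[symmetric] by (intro sum_norm_le P(2))
        also have "\<dots> \<le> (\<Sum>i. B * (1/2)^i)" using B by (intro sum_le_suminf geo) auto
        also have "\<dots> = 2 * B" by (subst suminf_mult) (auto simp: suminf_geometric intro!: summable_geometric)
        finally show ?thesis by (simp add: B_def)
      qed
      then show "\<forall>n\<ge>0. norm (P n - p) \<le> 4 * (\<eta> / d) * (r + \<eta>)" by simp
    qed
  qed
qed

text \<open>
  For \<open>|b| \<le> r\<close> the vector \<open>b y + z\<close> is a convex combination of \<open>\<plusminus> r u y + z\<close> with \<open>|u| = 1\<close>; for larger \<open>|b|\<close>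
  only the multiple of \<open>y\<close> grows, and \<open>\<parallel>y\<parallel> \<le> 1\<close>.
\<close>

lemma norm_peak_le:
  assumes y: "norm y \<le> 1" and r: "0 < r"
    and le: "\<And>u. norm u = 1 \<Longrightarrow> norm (scale (of_real r * u) y + z) \<le> r"
  shows "norm (scale b y + z) \<le> max (norm b) r"
proof -
  obtain u where u: "norm u = 1" "b = of_real (norm b) * u"
  proof (cases "b = 0")
    case True then show thesis using that[of 1] by simp
  next
    case False then show thesis using that[of "b / of_real (norm b)"] by (simp add: norm_divide)
  qed
  define v where "v = scale u y"
  have b: "scale b y = norm b *\<^sub>R v" by (subst u(2)) (simp add: v_def scale_of_real flip: scale_scale)
  have rv: "scale (of_real r * u) y = r *\<^sub>R v" "scale (of_real r * (- u)) y = - (r *\<^sub>R v)"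
    by (simp_all add: v_def scale_of_real flip: scale_scale)
  have l1: "norm (r *\<^sub>R v + z) \<le> r" using le[OF u(1)] rv by simp
  have l2: "norm (- (r *\<^sub>R v) + z) \<le> r" using le[of "- u"] u(1) rv by simp
  show ?thesis
  proof (cases "norm b \<le> r")
    case True
    define t where "t = norm b / r"
    have t: "0 \<le> t" "t \<le> 1" "norm b = t * r" using True r by (auto simp: t_def)
    have "scale b y + z = ((1 + t) / 2) *\<^sub>R (r *\<^sub>R v + z) + ((1 - t) / 2) *\<^sub>R (- (r *\<^sub>R v) + z)"
    proof -
      have "((1 + t) / 2) *\<^sub>R (r *\<^sub>R v + z) + ((1 - t) / 2) *\<^sub>R (- (r *\<^sub>R v) + z) =
          (((1 + t) / 2) * r - ((1 - t) / 2) * r) *\<^sub>R v + ((1 + t) / 2 + (1 - t) / 2) *\<^sub>R z"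
        by (simp only: scaleR_add_left scaleR_diff_left scaleR_add_right scaleR_minus_right scaleR_scaleR) simp
      also have "((1 + t) / 2) * r - ((1 - t) / 2) * r = norm b" using t(3) by (simp add: field_simps)
      also have "(1 + t) / 2 + (1 - t) / 2 = 1" by (simp add: field_simps)
      finally show ?thesis using b by simp
    qed
    also have "norm \<dots> \<le> ((1 + t) / 2) * r + ((1 - t) / 2) * r"
      using t l1 l2 by (intro norm_triangle_mono) (auto intro!: mult_left_mono)
    also have "\<dots> = r" by (simp add: field_simps)
    finally show ?thesis by simp
  next
    case False
    have "scale b y + z = (norm b - r) *\<^sub>R v + (r *\<^sub>R v + z)" using b by (simp add: algebra_simps)
    also have "norm \<dots> \<le> (norm b - r) * 1 + r"
      using False y u(1) l1 by (intro norm_triangle_mono) (auto simp: v_def norm_scale intro!: mult_left_mono)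
    finally show ?thesis by simp
  qed
qed

end

section \<open>Smooth points of the dual and range strongly exposing operators\<close>

text \<open>
  If \<open>u\<^sub>n\<close> almost norms \<open>f\<close>, then \<open>\<parallel>f\<parallel> + t Re g(u\<^sub>n)\<close> is almost bounded by \<open>\<parallel>f + t g\<parallel>\<close>, so \<open>Re g(u\<^sub>n)\<close> is almost
  bounded by a difference quotient of the norm.
\<close>

lemma Smulyan_upper:
  fixes f g :: "'a::banach \<Rightarrow>\<^sub>L 'k::real_or_complex_field"
  assumes lim: "((\<lambda>t. (norm (f + t *\<^sub>R g) - norm f) / t) \<longlongrightarrow> d) (at 0)"
    and u: "\<And>n. norm (u n) \<le> 1" "(\<lambda>n. re_part (blinfun_apply f (u n))) \<longlonglongrightarrow> norm f"
    and a: "d < a"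
  shows "\<forall>\<^sub>F n in sequentially. re_part (blinfun_apply g (u n)) < a"
proof -
  obtain a' where a': "d < a'" "a' < a" using a dense by blast
  have "\<forall>\<^sub>F t in at_right 0. (norm (f + t *\<^sub>R g) - norm f) / t < a'"
    using filterlim_mono[OF lim order_refl at_le[OF subset_UNIV]] a'(1) by (rule order_tendstoD)
  moreover have "\<forall>\<^sub>F t in at_right (0::real). 0 < t" by (simp add: eventually_at_right_less)
  ultimately have "\<forall>\<^sub>F t in at_right 0. (norm (f + t *\<^sub>R g) - norm f) / t < a' \<and> 0 < t"
    by (rule eventually_conj)
  then obtain t where t: "(norm (f + t *\<^sub>R g) - norm f) / t < a'" "0 < t"
    using eventually_happens by fastforce
  have tp: "0 < t * (a - a')" using t a' by simp
  have "\<forall>\<^sub>F n in sequentially. norm f - t * (a - a') < re_part (blinfun_apply f (u n))"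
    by (rule order_tendstoD[OF u(2)]) (use tp in simp)
  then show ?thesis
  proof eventually_elim
    case (elim n)
    have "re_part (blinfun_apply (f + t *\<^sub>R g) (u n)) \<le> norm (f + t *\<^sub>R g)"
      using abs_re_part_le[of "blinfun_apply (f + t *\<^sub>R g) (u n)"] norm_blinfun_on_ball[OF u(1), of "f + t *\<^sub>R g" n]
      by linarith
    then have "re_part (blinfun_apply f (u n)) + t * re_part (blinfun_apply g (u n)) \<le> norm (f + t *\<^sub>R g)"
      by (simp add: blinfun.add_left blinfun.scaleR_left linear_add[OF linear_re_part] linear_scale[OF linear_re_part])
    moreover have "norm (f + t *\<^sub>R g) < norm f + t * a'" using t by (simp add: field_simps)
    ultimately have "t * re_part (blinfun_apply g (u n)) < t * a' + t * (a - a')" using elim by linarith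
    then have "t * re_part (blinfun_apply g (u n)) < t * a" by (simp add: algebra_simps)
    then show ?case using t by simp
  qed
qed

text \<open>
  By linearity of the derivative, the upper bounds for \<open>g\<close> and \<open>- g\<close> force \<open>Re g(u\<^sub>n)\<close> to converge to the
  derivative in direction \<open>g\<close>. The constant sequence \<open>x\<close> is also norming, so this limit is \<open>Re g(x)\<close>.
\<close>

lemma Smulyan:
  fixes s :: "'k::real_or_complex_field \<Rightarrow> 'a::banach \<Rightarrow> 'a"
  assumes f: "f \<in> smooth_dual_points s"
    and x: "norm x \<le> 1" "blinfun_apply f x = of_real (norm f)"
    and u: "\<And>n. norm (u n) \<le> 1" "(\<lambda>n. blinfun_apply f (u n)) \<longlonglongrightarrow> of_real (norm f)"
    and g: "g \<in> dual_space s"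
  shows "(\<lambda>n. blinfun_apply g (u n)) \<longlonglongrightarrow> blinfun_apply g x"
proof -
  obtain D where D: "\<And>r h. h \<in> dual_space s \<Longrightarrow> D (r *\<^sub>R h) = r * D h"
    "\<And>h. h \<in> dual_space s \<Longrightarrow> ((\<lambda>t. (norm (f + t *\<^sub>R h) - norm f) / t) \<longlongrightarrow> D h) (at 0)"
    using f unfolding smooth_dual_points_def gateaux_differentiable_in_def by blast
  have conv: "(\<lambda>n. re_part (blinfun_apply h (v n))) \<longlonglongrightarrow> D h"
    if h: "h \<in> dual_space s" and v: "\<And>n. norm (v n) \<le> 1" "(\<lambda>n. blinfun_apply f (v n)) \<longlonglongrightarrow> of_real (norm f)"
    for h v
  proof -
    have re: "(\<lambda>n. re_part (blinfun_apply f (v n))) \<longlonglongrightarrow> norm f"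
      using bounded_linear.tendsto[OF bounded_linear_re_part v(2)] by (simp add: re_part_of_real)
    have mh: "- h \<in> dual_space s" "D (- h) = - D h"
      using Real_Vector_Spaces.subspace_neg[OF subspace_dual_space h] D(1)[OF h, of "-1"] by auto
    show ?thesis
    proof (rule order_tendstoI)
      show "\<forall>\<^sub>F n in sequentially. re_part (blinfun_apply h (v n)) < a" if "D h < a" for a
        using Smulyan_upper[OF D(2)[OF h] v(1) re that] .
      show "\<forall>\<^sub>F n in sequentially. a < re_part (blinfun_apply h (v n))" if "a < D h" for a
        using Smulyan_upper[OF D(2)[OF mh(1)] v(1) re, of "- a"] that mh(2)
        by (simp add: blinfun.minus_left linear_neg[OF linear_re_part])
    qed
  qed
  show ?thesis
  proof (rule tendsto_re_partI)
    fix c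
    let ?h = "scale_functional c g"
    have h: "?h \<in> dual_space s" by (rule scale_functional_in_dual[OF g])
    have "(\<lambda>n. re_part (blinfun_apply ?h x)) \<longlonglongrightarrow> D ?h"
      by (rule conv[OF h, of "\<lambda>_. x"]) (use x in auto)
    then have "D ?h = re_part (blinfun_apply ?h x)" using LIMSEQ_unique tendsto_const by blast
    then show "(\<lambda>n. re_part (c * blinfun_apply g (u n))) \<longlonglongrightarrow> re_part (c * blinfun_apply g x)"
      using conv[OF h u] by simp
  qed
qed

lemma bounded_ops_apply: "T \<in> bounded_ops sX sY \<Longrightarrow> blinfun_apply T (sX c x) = sY c (blinfun_apply T x)"
  by (simp add: bounded_ops_def)

lemma functional_compose_op_in_dual:
  assumes "T \<in> bounded_ops sX sY" "\<psi> \<in> dual_space sY"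
  shows "\<psi> o\<^sub>L T \<in> dual_space sX"
  using assms by (simp add: dual_space_iff bounded_ops_apply)

lemma compact_opsI:
  assumes "T \<in> bounded_ops sX sY" "compact C" "blinfun_apply T ` cball 0 1 \<subseteq> C"
  shows "T \<in> compact_ops sX sY"
proof -
  have "closure (blinfun_apply T ` cball 0 1) \<subseteq> C"
    using assms by (simp add: closure_minimal compact_imp_closed)
  then have "compact (closure (blinfun_apply T ` cball 0 1))"
    using compact_Int_closed[OF assms(2) closed_closure, of "blinfun_apply T ` cball 0 1"] by (simp add: Int_absorb1)
  then show ?thesis using assms(1) by (simp add: compact_ops_def)
qed

text \<open>
  A net for the image of the ball under an operator close to \<open>L\<close> is a coarser net for the image under \<open>L\<close>.
\<close>

lemma closed_compact_ops:
  assumes "banach_space_over sY"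
  shows "closed (compact_ops sX sY)"
proof -
  interpret Y: banach_space_over sY by fact
  show ?thesis
    unfolding closed_sequential_limits
  proof (intro allI impI, elim conjE)
    fix T :: "nat \<Rightarrow> _" and L assume "\<forall>n. T n \<in> compact_ops sX sY" and lim: "T \<longlonglongrightarrow> L"
    then have T: "T n \<in> compact_ops sX sY" for n by blast
    have app: "(\<lambda>n. blinfun_apply (T n) x) \<longlonglongrightarrow> blinfun_apply L x" for x
      by (intro tendsto_intros lim)
    have L: "L \<in> bounded_ops sX sY"
      unfolding bounded_ops_def
    proof (intro CollectI allI)
      fix c x
      have "(\<lambda>n. sY c (blinfun_apply (T n) x)) \<longlonglongrightarrow> sY c (blinfun_apply L x)"
        by (rule bounded_linear.tendsto[OF Y.bounded_linear_scale_right app])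
      moreover have "blinfun_apply (T n) (sX c x) = sY c (blinfun_apply (T n) x)" for n
        using T[of n] by (simp add: compact_ops_def bounded_ops_apply)
      ultimately show "blinfun_apply L (sX c x) = sY c (blinfun_apply L x)"
        using app[of "sX c x"] LIMSEQ_unique by auto
    qed
    have "\<exists>k. finite k \<and> closure (blinfun_apply L ` cball 0 1) \<subseteq> (\<Union>y\<in>k. ball y e)" if e: "e > 0" for e
    proof -
      obtain n where n: "norm (L - T n) < e / 3"
        using LIMSEQ_D[OF lim, of "e / 3"] e by (metis norm_minus_commute order_refl zero_less_divide_iff zero_less_numeral)
      have "compact (closure (blinfun_apply (T n) ` cball 0 1))" using T[of n] by (simp add: compact_ops_def)
      then obtain k where k: "finite k" "closure (blinfun_apply (T n) ` cball 0 1) \<subseteq> (\<Union>y\<in>k. ball y (e / 3))"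
        using e unfolding compact_eq_totally_bounded by (metis zero_less_divide_iff zero_less_numeral)
      have "blinfun_apply L ` cball 0 1 \<subseteq> (\<Union>y\<in>k. cball y (2 * e / 3))"
      proof
        fix w assume "w \<in> blinfun_apply L ` cball 0 1"
        then obtain x where x: "norm x \<le> 1" "w = blinfun_apply L x" by auto
        have "blinfun_apply (T n) x \<in> closure (blinfun_apply (T n) ` cball 0 1)"
          using x(1) closure_subset by fastforce
        then obtain y where y: "y \<in> k" "dist y (blinfun_apply (T n) x) < e / 3" using k(2) by auto
        have "norm (blinfun_apply (L - T n) x) < e / 3"
          using norm_blinfun_on_ball[OF x(1), of "L - T n"] n by simp
        then have "dist (blinfun_apply (T n) x) w < e / 3"
          by (simp add: x(2) dist_norm blinfun.diff_left norm_minus_commute)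
        then have "dist y w \<le> 2 * e / 3" using y(2) dist_triangle[of y w "blinfun_apply (T n) x"] by simp
        then show "w \<in> (\<Union>y\<in>k. cball y (2 * e / 3))" using y(1) by auto
      qed
      then have "closure (blinfun_apply L ` cball 0 1) \<subseteq> (\<Union>y\<in>k. cball y (2 * e / 3))"
        by (rule closure_minimal) (use k(1) in auto)
      also have "\<dots> \<subseteq> (\<Union>y\<in>k. ball y e)" using e by fastforce
      finally show ?thesis using k(1) by blast
    qed
    then have "compact (closure (blinfun_apply L ` cball 0 1))"
      unfolding compact_eq_totally_bounded by (simp add: complete_eq_closed)
    then show "L \<in> compact_ops sX sY" using L by (simp add: compact_ops_def)
  qed
qed

lemma zero_op_range_strongly_exposing:
  assumes X: "banach_space_over sX" and Y: "banach_space_over sY"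
  shows "0 \<in> range_strongly_exposing sX sY"
proof -
  interpret X: banach_space_over sX by fact
  interpret Y: banach_space_over sY by fact
  obtain x :: 'b where "x \<noteq> 0" using X.nonzero by blast
  then have x: "norm ((1 / norm x) *\<^sub>R x) = 1" by simp
  have "\<exists>(\<sigma> :: nat \<Rightarrow> nat) \<theta>. strict_mono \<sigma> \<and> norm \<theta> = 1 \<and>
      (\<lambda>n. blinfun_apply 0 (v (\<sigma> n))) \<longlonglongrightarrow> sY \<theta> (blinfun_apply 0 ((1 / norm x) *\<^sub>R x))" for v
    by (intro exI[of _ id] exI[of _ 1]) (auto simp: strict_mono_def)
  then show ?thesis
    unfolding range_strongly_exposing_def using x by (auto simp: bounded_ops_def intro!: exI[of _ "(1 / norm x) *\<^sub>R x"])
qed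

text \<open>
  Since \<open>r < \<parallel>f\<parallel> = \<parallel>S\<parallel>\<close>, the two inequalities give \<open>\<parallel>S x\<^sub>n\<parallel> = |f(x\<^sub>n)|\<close> eventually along a maximizing
  sequence. On a subsequence \<open>f(x\<^sub>n)\<close> tends to \<open>\<theta> \<parallel>f\<parallel>\<close> and \<open>S x\<^sub>n\<close> converges in norm; \<open>Smulyan\<close>, applied to
  \<open>x\<^sub>n / \<theta>\<close> and the functionals \<open>\<psi> \<circ> S\<close>, identifies the limit as \<open>\<theta> S x\<^sub>0\<close>.
\<close>

lemma range_strongly_exposingI:
  assumes X: "banach_space_over sX" and Y: "banach_space_over sY"
    and S: "S \<in> compact_ops sX sY" and f: "f \<in> smooth_dual_points sX \<inter> norm_attaining sX"
    and r: "0 \<le> r" "r < norm f"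
    and le: "\<And>x. norm x \<le> 1 \<Longrightarrow> norm (blinfun_apply S x) \<le> max (norm (blinfun_apply f x)) r"
    and ge: "\<And>x. norm (blinfun_apply f x) \<le> norm (blinfun_apply S x)"
  shows "S \<in> range_strongly_exposing sX sY"
proof -
  interpret X: banach_space_over sX by fact
  interpret Y: banach_space_over sY by fact
  have S': "S \<in> bounded_ops sX sY" "compact (closure (blinfun_apply S ` cball 0 1))"
    using S by (auto simp: compact_ops_def)
  have fd: "f \<in> dual_space sX" using f by (simp add: norm_attaining_def)
  obtain x1 where x1: "norm x1 \<le> 1" "norm (blinfun_apply f x1) = norm f"
    using f by (auto simp: norm_attaining_def)
  have nS: "norm S = norm f"
  proof (rule antisym)
    show "norm S \<le> norm f"
    proof (rule norm_blinfun_le_on_ball)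
      fix x :: 'b assume "norm x \<le> 1"
      then show "norm (blinfun_apply S x) \<le> norm f"
        using le[of x] norm_blinfun_on_ball[of x f] r by simp
    qed simp
    show "norm f \<le> norm S" using x1 ge[of x1] norm_blinfun_on_ball[OF x1(1), of S] by simp
  qed
  \<comment> \<open>Rotated so that the value of \<open>f\<close> is real and positive, as \<open>Smulyan\<close> requires.\<close>
  define x0 where "x0 = sX (of_real (norm f) / blinfun_apply f x1) x1"
  have nf: "norm f > 0" using r by linarith
  then have fx1: "blinfun_apply f x1 \<noteq> 0" using x1(2) by (metis norm_zero less_irrefl)
  have fx0: "blinfun_apply f x0 = of_real (norm f)"
    using fx1 by (simp add: x0_def dual_space_apply[OF fd])
  have "norm (of_real (norm f) / blinfun_apply f x1) = 1"
    using x1(2) nf by (simp add: norm_divide)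
  then have x0le: "norm x0 \<le> 1" unfolding x0_def X.norm_scale using x1(1) by simp
  have "norm f \<le> norm f * norm x0" using norm_blinfun[of f x0] fx0 by simp
  then have "1 \<le> norm x0" using nf mult_le_cancel_left1[of "norm f" "norm x0"] by simp
  then have x0: "norm x0 = 1" using x0le by simp
  have "\<exists>(\<sigma> :: nat \<Rightarrow> nat) \<theta>. strict_mono \<sigma> \<and> norm \<theta> = 1 \<and>
      (\<lambda>n. blinfun_apply S (x (\<sigma> n))) \<longlonglongrightarrow> sY \<theta> (blinfun_apply S x0)"
    if x: "\<And>n. norm (x n) \<le> 1" and lim: "(\<lambda>n. norm (blinfun_apply S (x n))) \<longlonglongrightarrow> norm S" for x :: "nat \<Rightarrow> 'b"
  proof -
    have "\<forall>\<^sub>F n in sequentially. r < norm (blinfun_apply S (x n))"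
      using lim r nS by (intro order_tendstoD(1)[OF lim]) simp
    then have "\<forall>\<^sub>F n in sequentially. norm (blinfun_apply S (x n)) = norm (blinfun_apply f (x n))"
    proof eventually_elim
      case (elim n)
      then show ?case using le[OF x, of n] ge[of "x n"] by simp
    qed
    then have limf: "(\<lambda>n. norm (blinfun_apply f (x n))) \<longlonglongrightarrow> norm f"
      using lim nS tendsto_cong by fastforce
    have mem: "\<forall>n. (blinfun_apply f (x n), blinfun_apply S (x n)) \<in>
        cball 0 (norm f) \<times> closure (blinfun_apply S ` cball 0 1)"
      using x norm_blinfun_on_ball[OF x, of f] closure_subset by fastforce
    have sq: "seq_compact (cball 0 (norm f) \<times> closure (blinfun_apply S ` cball 0 1) :: ('a \<times> 'c) set)"
      using compact_Times[OF compact_cball_scalars S'(2)] compact_imp_seq_compact by blast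
    obtain l \<sigma> where \<sigma>: "strict_mono (\<sigma> :: nat \<Rightarrow> nat)"
      and l: "((\<lambda>n. (blinfun_apply f (x n), blinfun_apply S (x n))) \<circ> \<sigma>) \<longlonglongrightarrow> l"
      using seq_compactE[OF sq mem] by blast
    have lf: "(\<lambda>n. blinfun_apply f (x (\<sigma> n))) \<longlonglongrightarrow> fst l"
      and lS: "(\<lambda>n. blinfun_apply S (x (\<sigma> n))) \<longlonglongrightarrow> snd l"
      using tendsto_fst[OF l] tendsto_snd[OF l] by (auto simp: o_def)
    have "(\<lambda>n. norm (blinfun_apply f (x (\<sigma> n)))) \<longlonglongrightarrow> norm f"
      using LIMSEQ_subseq_LIMSEQ[OF limf \<sigma>] by (simp add: o_def)
    then have nl: "norm (fst l) = norm f" using LIMSEQ_unique tendsto_norm[OF lf] by blast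
    define \<theta> where "\<theta> = fst l / of_real (norm f)"
    have \<theta>: "norm \<theta> = 1" "\<theta> \<noteq> 0" "fst l = \<theta> * of_real (norm f)"
      using nl r by (auto simp: \<theta>_def norm_divide)
    have "snd l = sY \<theta> (blinfun_apply S x0)"
    proof (rule Y.dual_separates_points)
      fix \<psi> assume \<psi>: "\<psi> \<in> dual_space sY"
      let ?g = "\<psi> o\<^sub>L S"
      have g: "?g \<in> dual_space sX" by (rule functional_compose_op_in_dual[OF S'(1) \<psi>])
      let ?u = "\<lambda>n. sX (inverse \<theta>) (x (\<sigma> n))"
      have "(\<lambda>n. inverse \<theta> * blinfun_apply f (x (\<sigma> n))) \<longlonglongrightarrow> inverse \<theta> * fst l"
        by (intro tendsto_intros lf)
      moreover have "inverse \<theta> * fst l = of_real (norm f)" using \<theta> by simp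
      ultimately have "(\<lambda>n. blinfun_apply f (?u n)) \<longlonglongrightarrow> of_real (norm f)"
        by (simp only: dual_space_apply[OF fd])
      then have "(\<lambda>n. blinfun_apply ?g (?u n)) \<longlonglongrightarrow> blinfun_apply ?g x0"
        using f x \<theta> by (intro Smulyan[OF _ x0le fx0 _ _ g]) (auto simp: X.norm_scale norm_inverse)
      then have "(\<lambda>n. \<theta> * blinfun_apply ?g (?u n)) \<longlonglongrightarrow> \<theta> * blinfun_apply ?g x0"
        by (rule tendsto_mult_left)
      moreover have "\<theta> * blinfun_apply ?g (?u n) = blinfun_apply \<psi> (blinfun_apply S (x (\<sigma> n)))" for n
        using \<theta> dual_space_apply[OF g, of "inverse \<theta>" "x (\<sigma> n)"] by simp
      ultimately have "(\<lambda>n. blinfun_apply \<psi> (blinfun_apply S (x (\<sigma> n)))) \<longlonglongrightarrow> \<theta> * blinfun_apply ?g x0" by simp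
      moreover have "(\<lambda>n. blinfun_apply \<psi> (blinfun_apply S (x (\<sigma> n)))) \<longlonglongrightarrow> blinfun_apply \<psi> (snd l)"
        by (intro tendsto_intros lS)
      ultimately show "blinfun_apply \<psi> (snd l) = blinfun_apply \<psi> (sY \<theta> (blinfun_apply S x0))"
        using LIMSEQ_unique by (fastforce simp: dual_space_apply[OF \<psi>])
    qed
    then show ?thesis using \<sigma> \<theta> lS by (intro exI[of _ \<sigma>] exI[of _ \<theta>]) simp
  qed
  then show ?thesis unfolding range_strongly_exposing_def using S'(1) x0 by blast
qed

section \<open>Density of the range strongly exposing compact operators\<close>

lemma L1_predual_extreme_L_summand:
  assumes Y: "L1_predual TYPE('m) (sY :: 'k::real_or_complex_field \<Rightarrow> 'b::banach \<Rightarrow> 'b)"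
    and \<phi>: "\<phi> \<in> dual_space sY" "norm \<phi> \<le> 1" "\<phi> \<noteq> 0"
    and ext: "\<And>g. g \<in> dual_space sY \<Longrightarrow> norm (\<phi> + g) \<le> 1 \<Longrightarrow> norm (\<phi> - g) \<le> 1 \<Longrightarrow> g = 0"
  obtains \<alpha> where "L_summand_coefficient sY \<phi> \<alpha>"
proof -
  have Yb: "banach_space_over sY" using Y unfolding L1_predual_def by blast
  obtain \<mu> :: "'m measure" where "dual_isometric_to_L1 sY \<mu>"
    using Y unfolding L1_predual_def by blast
  then obtain \<Phi> where \<Phi>: "bij_betw \<Phi> (L1_space \<mu>) (dual_space sY) \<and>
       (\<forall>f g. integrable \<mu> f \<and> integrable \<mu> g \<longrightarrow>
          \<Phi> (L1_class \<mu> (\<lambda>t. f t + g t)) = \<Phi> (L1_class \<mu> f) + \<Phi> (L1_class \<mu> g)) \<and>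
       (\<forall>c f y. integrable \<mu> f \<longrightarrow>
          blinfun_apply (\<Phi> (L1_class \<mu> (\<lambda>t. c * f t))) y = c * blinfun_apply (\<Phi> (L1_class \<mu> f)) y) \<and>
       (\<forall>f. integrable \<mu> f \<longrightarrow> norm (\<Phi> (L1_class \<mu> f)) = (\<integral>t. norm (f t) \<partial>\<mu>))"
    unfolding dual_isometric_to_L1_def by (rule exE)
  have img: "\<Phi> ` L1_space \<mu> = dual_space sY" using \<Phi> by (simp add: bij_betw_def)
  interpret dual_is_L1 sY \<mu> "\<lambda>f. \<Phi> (L1_class \<mu> f)"
  proof (intro dual_is_L1.intro[OF Yb] dual_is_L1_axioms.intro)
    show "\<Phi> (L1_class \<mu> f) \<in> dual_space sY" if "integrable \<mu> f" for f
      using img that unfolding L1_space_def by blast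
    show "\<exists>f. integrable \<mu> f \<and> \<Phi> (L1_class \<mu> f) = \<psi>" if "\<psi> \<in> dual_space sY" for \<psi>
      using that unfolding img[symmetric] L1_space_def by blast
    show "\<Phi> (L1_class \<mu> (\<lambda>t. c * f t)) = scale_functional c (\<Phi> (L1_class \<mu> f))" if "integrable \<mu> f" for f c
      by (rule blinfun_eqI) (simp add: \<Phi> that)
  qed (simp_all add: \<Phi>)
  show thesis by (rule extreme_functional_L_summand[OF \<phi> ext that])
qed

text \<open>
  The construction described at the beginning, with constants. All depend on \<open>\<delta>\<close>: the norming vector \<open>x\<close> and the
  functional \<open>f\<close> cost \<open>\<delta>\<close> each, so \<open>\<parallel>f\<parallel>\<close> exceeds \<open>r = \<tau> - 2 \<delta>\<close>; the factor \<open>\<rho> = 1 - 4 \<delta> / \<tau>\<close>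
  brings \<open>R\<close> below \<open>r - \<delta>\<close>, which is the gap that \<open>exact_peak\<close> uses; and the accuracy \<open>\<eta> = \<delta>\<^sup>2\<close> of the approximate
  peak is small compared with this gap, so that the correction from \<open>y\<^sub>0\<close> to \<open>y\<close>, of order \<open>\<eta> / \<delta>\<close>, is small.
\<close>

lemma compact_op_near_range_strongly_exposing:
  fixes sX :: "'k::real_or_complex_field \<Rightarrow> 'a::banach \<Rightarrow> 'a"
    and sY :: "'k \<Rightarrow> 'b::banach \<Rightarrow> 'b"
  assumes X: "banach_space_over sX"
    and dense: "dual_space sX \<subseteq> closure (smooth_dual_points sX \<inter> norm_attaining sX)"
    and Y: "L1_predual TYPE('m) sY"
    and T: "T \<in> compact_ops sX sY" "T \<noteq> 0" and e: "0 < e"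
  obtains S where "S \<in> compact_ops sX sY \<inter> range_strongly_exposing sX sY" "norm (S - T) < e"
proof -
  have Yb: "banach_space_over sY" using Y unfolding L1_predual_def by blast
  interpret X: banach_space_over sX by fact
  interpret Y: banach_space_over sY by fact
  have Tb: "T \<in> bounded_ops sX sY" and Tc: "compact (closure (blinfun_apply T ` cball 0 1))"
    using T by (auto simp: compact_ops_def)
  define \<tau> where "\<tau> = norm T"
  have \<tau>: "0 < \<tau>" using T by (simp add: \<tau>_def)
  define \<delta> where "\<delta> = min (\<tau> / 8) (min 1 (e / (2 * (9 + 8 * \<tau>))))"
  have \<delta>: "0 < \<delta>" "\<delta> \<le> \<tau> / 8" "\<delta> \<le> 1" "\<delta> * (9 + 8 * \<tau>) < e"
  proof -
    show "0 < \<delta>" using \<tau> e by (simp add: \<delta>_def)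
    show "\<delta> \<le> \<tau> / 8" unfolding \<delta>_def by (rule min.cobounded1)
    show "\<delta> \<le> 1" unfolding \<delta>_def by (intro min.coboundedI2 min.cobounded1)
    have "\<delta> \<le> e / (2 * (9 + 8 * \<tau>))" by (simp add: \<delta>_def)
    then have "\<delta> * (9 + 8 * \<tau>) \<le> e / (2 * (9 + 8 * \<tau>)) * (9 + 8 * \<tau>)"
      using \<tau> by (intro mult_right_mono) auto
    also have "\<dots> = e / 2" using \<tau> by (simp add: field_simps)
    finally show "\<delta> * (9 + 8 * \<tau>) < e" using e by simp
  qed
  define \<eta> where "\<eta> = \<delta> * \<delta>"
  have \<eta>: "0 < \<eta>" "\<eta> \<le> \<delta>" "\<eta> / \<delta> = \<delta>"
    using \<delta> mult_left_le[of \<delta> \<delta>] by (auto simp: \<eta>_def)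
  define r where "r = \<tau> - 2 * \<delta>"
  have r: "0 < r" "r < \<tau>" "\<eta> \<le> r" using \<delta> \<eta> \<tau> by (auto simp: r_def)
  define \<rho> where "\<rho> = (\<tau> - 4 * \<delta>) / \<tau>"
  have \<rho>: "0 \<le> \<rho>" "\<rho> \<le> 1" "\<rho> * \<tau> = \<tau> - 4 * \<delta>" "1 - \<rho> = 4 * \<delta> / \<tau>"
    using \<delta> \<tau> by (auto simp: \<rho>_def field_simps)
  obtain x where x: "norm x \<le> 1" "\<tau> - \<delta> < norm (blinfun_apply T x)"
  proof (rule ccontr)
    assume "\<not> thesis"
    then have "norm T \<le> \<tau> - \<delta>" using that \<delta> \<tau>
      by (intro norm_blinfun_le_on_ball) (auto simp: not_less intro: leI)
    then show False using \<delta> by (simp add: \<tau>_def)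
  qed
  obtain \<phi> where \<phi>: "\<phi> \<in> dual_space sY" "norm \<phi> \<le> 1"
    "norm (blinfun_apply T x) \<le> norm (blinfun_apply \<phi> (blinfun_apply T x))"
    and ext: "\<And>g. g \<in> dual_space sY \<Longrightarrow> norm (\<phi> + g) \<le> 1 \<Longrightarrow> norm (\<phi> - g) \<le> 1 \<Longrightarrow> g = 0"
  proof (rule Y.extreme_norming_functional[of "blinfun_apply T x"])
    fix \<phi> assume "\<phi> \<in> dual_space sY" "norm \<phi> \<le> 1"
      "norm (blinfun_apply T x) \<le> norm (blinfun_apply \<phi> (blinfun_apply T x))"
      "\<And>g. g \<in> dual_space sY \<Longrightarrow> norm (\<phi> + g) \<le> 1 \<Longrightarrow> norm (\<phi> - g) \<le> 1 \<Longrightarrow> g = 0"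
    then show thesis by (rule that)
  qed
  have \<phi>0: "\<phi> \<noteq> 0" using \<phi>(3) x \<delta> \<tau> by auto
  obtain \<alpha> where \<alpha>: "L_summand_coefficient sY \<phi> \<alpha>"
    by (rule L1_predual_extreme_L_summand[OF Y \<phi>(1,2) \<phi>0 ext])
  define f0 where "f0 = \<phi> o\<^sub>L T"
  have f0: "f0 \<in> dual_space sX" "\<And>v. blinfun_apply f0 v = blinfun_apply \<phi> (blinfun_apply T v)"
    using functional_compose_op_in_dual[OF Tb \<phi>(1)] by (auto simp: f0_def)
  have nf0: "\<tau> - \<delta> < norm f0"
    using x \<phi>(3) norm_blinfun_on_ball[OF x(1), of f0] by (simp add: f0(2))
  have \<phi>le: "norm (blinfun_apply \<phi> w) \<le> norm w" for w
    using norm_blinfun[of \<phi> w] mult_right_mono[OF \<phi>(2), of "norm w"] by simp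
  obtain f where f: "f \<in> smooth_dual_points sX \<inter> norm_attaining sX" "dist f f0 < \<delta>"
  proof -
    have "f0 \<in> closure (smooth_dual_points sX \<inter> norm_attaining sX)" using dense f0(1) by blast
    then show thesis using that \<delta>(1) unfolding closure_approachable by blast
  qed
  have fd: "f \<in> dual_space sX" using f(1) by (simp add: norm_attaining_def)
  have nf: "r < norm f"
    using f(2) nf0 norm_triangle_ineq2[of f0 f] by (simp add: r_def dist_norm norm_minus_commute)
  define K0 where "K0 = closure (blinfun_apply T ` cball 0 1)"
  have K0: "compact K0" using Tc by (simp add: K0_def)
  have TK0: "blinfun_apply T v \<in> K0" if "norm v \<le> 1" for v
    unfolding K0_def using that closure_subset by fastforce
  have K0\<tau>: "norm z \<le> \<tau>" if "z \<in> K0" for z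
  proof -
    have "K0 \<subseteq> cball 0 \<tau>" unfolding K0_def \<tau>_def
      by (rule closure_minimal) (auto intro: norm_blinfun_on_ball)
    then show ?thesis using that by auto
  qed
  obtain y0 where y0: "blinfun_apply \<phi> y0 = 1"
    "\<And>z a. z \<in> K0 \<Longrightarrow> norm a \<le> \<tau> \<Longrightarrow> norm (z + sY (a - blinfun_apply \<phi> z) y0) \<le> \<tau> + \<eta>"
  proof (rule Y.approximate_peak[OF \<alpha> \<phi>(1) K0 _ \<tau> \<eta>(1)])
    show "norm z \<le> \<tau>" if "z \<in> K0" for z using K0\<tau>[OF that] .
    fix y assume "blinfun_apply \<phi> y = 1"
      "\<And>z a. z \<in> K0 \<Longrightarrow> norm a \<le> \<tau> \<Longrightarrow> norm (z + sY (a - blinfun_apply \<phi> z) y) \<le> \<tau> + \<eta>"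
    then show thesis by (rule that)
  qed
  \<comment> \<open>The map that splits off the peak; \<open>R0 \<circ> T\<close> plays the part of the remainder \<open>R\<^sub>0\<close>, with values in \<open>ker \<phi>\<close>.\<close>
  define R0 where "R0 z = z - sY (blinfun_apply \<phi> z) y0" for z
  have R0\<phi>: "blinfun_apply \<phi> (R0 z) = 0" for z
    by (simp add: R0_def blinfun.diff_right dual_space_apply[OF \<phi>(1)] y0(1))
  have R0a: "norm (sY a y0 + R0 z) \<le> \<tau> + \<eta>" if "z \<in> K0" "norm a \<le> \<tau>" for z a
    using y0(2)[OF that] by (simp add: R0_def Y.scale_left_diff_distrib algebra_simps)
  have R0n: "norm (R0 z) \<le> \<tau> + \<eta>" if "z \<in> K0" for z using R0a[OF that, of 0] \<tau> by simp
  define K where "K = (\<lambda>z. \<rho> *\<^sub>R R0 z) ` K0"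
  have cont: "continuous_on A (\<lambda>z. sY (blinfun_apply \<phi> z) y0)" for A
    by (intro bounded_bilinear.continuous_on[OF Y.bounded_bilinear_scale] continuous_intros)
  have K: "compact K" unfolding K_def R0_def
    by (intro compact_continuous_image K0 continuous_intros cont)
  have z0: "0 \<in> K0" using TK0[of 0] by simp
  have R00: "R0 0 = 0" by (simp add: R0_def)
  have K00: "0 \<in> K" unfolding K_def using z0 R00 by (intro image_eqI[of _ _ 0]) auto
  have K\<phi>: "blinfun_apply \<phi> z = 0" if "z \<in> K" for z
    using that R0\<phi> by (auto simp: K_def blinfun.scaleR_right)
  have Kr: "norm z \<le> r - \<delta>" if z: "z \<in> K" for z
  proof -
    obtain w where w: "w \<in> K0" "z = \<rho> *\<^sub>R R0 w" using z unfolding K_def by blast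
    have "norm z \<le> \<rho> * (\<tau> + \<eta>)" using R0n[OF w(1)] \<rho> by (simp add: w(2) mult_left_mono)
    also have "\<dots> \<le> (\<tau> - 4 * \<delta>) + 1 * \<eta>"
      unfolding distrib_left \<rho>(3) using \<rho>(2) \<eta>(1) by (intro add_left_mono mult_right_mono) auto
    also have "\<dots> \<le> r - \<delta>" using \<eta> by (simp add: r_def)
    finally show ?thesis .
  qed
  define p0 where "p0 = r *\<^sub>R y0"
  have p0: "blinfun_apply \<phi> p0 = of_real r"
    by (simp add: p0_def blinfun.scaleR_right y0(1) of_real_def)
  have p0K: "norm (p0 + z) \<le> r + \<eta>" if z: "z \<in> K" for z
  proof -
    obtain w where w: "w \<in> K0" "z = \<rho> *\<^sub>R R0 w" using z unfolding K_def by blast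
    have l: "norm (\<tau> *\<^sub>R y0 + R0 w) \<le> \<tau> + \<eta>" "norm (\<tau> *\<^sub>R y0) \<le> \<tau> + \<eta>"
      using R0a[OF w(1), of "of_real \<tau>"] R0a[OF z0, of "of_real \<tau>"] \<tau> R00
      by (auto simp: Y.scale_of_real)
    have q: "0 \<le> r / \<tau> - \<rho>" using \<tau> \<delta> by (simp add: r_def \<rho>_def divide_right_mono flip: diff_divide_distrib)
    \<comment> \<open>A combination of two vectors of norm at most \<open>\<tau> + \<eta>\<close> with weights that add up to \<open>r / \<tau>\<close>.\<close>
    have "p0 + z = \<rho> *\<^sub>R (\<tau> *\<^sub>R y0 + R0 w) + (r / \<tau> - \<rho>) *\<^sub>R (\<tau> *\<^sub>R y0)"
    proof -
      have "\<rho> *\<^sub>R (\<tau> *\<^sub>R y0 + R0 w) + (r / \<tau> - \<rho>) *\<^sub>R (\<tau> *\<^sub>R y0) =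
          (\<rho> * \<tau> + (r / \<tau> - \<rho>) * \<tau>) *\<^sub>R y0 + \<rho> *\<^sub>R R0 w"
        by (simp only: scaleR_right_distrib scaleR_scaleR scaleR_left_distrib add_ac)
      also have "\<rho> * \<tau> + (r / \<tau> - \<rho>) * \<tau> = r" using \<tau> by (simp add: left_diff_distrib)
      finally show ?thesis by (simp add: p0_def w(2))
    qed
    also have "norm \<dots> \<le> \<rho> * (\<tau> + \<eta>) + (r / \<tau> - \<rho>) * (\<tau> + \<eta>)"
      using l \<rho>(1) q by (intro norm_triangle_mono) (simp_all only: norm_scaleR abs_of_nonneg mult_left_mono)
    also have "\<dots> = r + (r / \<tau>) * \<eta>" using \<tau> by (simp add: field_simps)
    also have "\<dots> \<le> r + 1 * \<eta>" using r \<tau> \<eta> by (intro add_left_mono mult_right_mono) auto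
    finally show ?thesis by simp
  qed
  obtain p where p: "blinfun_apply \<phi> p = of_real r" "\<And>z. z \<in> K \<Longrightarrow> norm (p + z) \<le> r"
    and pp0: "norm (p - p0) \<le> 4 * (\<eta> / \<delta>) * (r + \<eta>)"
  proof (rule Y.exact_peak[OF \<alpha> \<phi>(1) K K00 _ _ r(1) \<eta>(1,2) p0])
    show "blinfun_apply \<phi> z = 0" "norm z \<le> r - \<delta>" "norm (p0 + z) \<le> r + \<eta>" if "z \<in> K" for z
      using K\<phi> Kr p0K that by auto
    fix p assume "blinfun_apply \<phi> p = of_real r" "\<And>z. z \<in> K \<Longrightarrow> norm (p + z) \<le> r"
      "norm (p - p0) \<le> 4 * (\<eta> / \<delta>) * (r + \<eta>)"
    then show thesis by (rule that)
  qed
  define y where "y = (1 / r) *\<^sub>R p"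
  have py: "p = r *\<^sub>R y" using r by (simp add: y_def)
  have \<phi>y: "blinfun_apply \<phi> y = 1" using p(1) r by (simp add: y_def blinfun.scaleR_right scaleR_conv_of_real)
  have ny: "norm y \<le> 1" using p(2)[OF K00] r by (simp add: y_def field_simps)
  have yy0: "norm (y - y0) \<le> 8 * \<delta>"
  proof -
    have "r * norm (y - y0) = norm (p - p0)"
      unfolding py p0_def scaleR_right_diff_distrib[symmetric] using r by simp
    also have "\<dots> \<le> 4 * \<delta> * (r + r)"
      by (rule order_trans[OF pp0]) (use \<eta> \<delta> r in \<open>auto intro!: mult_left_mono\<close>)
    also have "\<dots> = r * (8 * \<delta>)" by simp
    finally show ?thesis using r by (simp only: mult_le_cancel_left_pos)
  qed
  define R where "R v = \<rho> *\<^sub>R R0 (blinfun_apply T v)" for v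
  define S where "S = Blinfun (\<lambda>v. sY (blinfun_apply f v) y + R v)"
  have "bounded_linear (\<lambda>v. sY (blinfun_apply f v) y + R v)"
    unfolding R_def R0_def
    by (intro bounded_linear_add bounded_linear_const_scaleR bounded_linear_sub blinfun.bounded_linear_right
        bounded_linear_compose[OF bounded_bilinear.bounded_linear_left[OF Y.bounded_bilinear_scale]]
        bounded_linear_compose[OF blinfun.bounded_linear_right])
  then have S: "blinfun_apply S v = sY (blinfun_apply f v) y + R v" for v
    by (simp add: S_def bounded_linear_Blinfun_apply)
  have R_scale: "R (sX c v) = sY c (R v)" for c v
    by (simp add: R_def R0_def bounded_ops_apply[OF Tb] dual_space_apply[OF \<phi>(1)]
        Y.scale_scaleR Y.scale_right_diff_distrib)
  have Sb: "S \<in> bounded_ops sX sY"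
    by (simp add: bounded_ops_def S R_scale dual_space_apply[OF fd] Y.scale_right_distrib)
  have RK: "R v \<in> K" if "norm v \<le> 1" for v unfolding R_def K_def using TK0[OF that] by (rule imageI)
  have Sc: "S \<in> compact_ops sX sY"
  proof (rule compact_opsI[OF Sb])
    let ?C = "(\<lambda>(c, z). sY c y + z) ` (cball 0 (norm f) \<times> K)"
    show "compact ?C"
      unfolding case_prod_beta
      by (intro compact_continuous_image compact_Times compact_cball_scalars K continuous_intros
          bounded_bilinear.continuous_on[OF Y.bounded_bilinear_scale])
    show "blinfun_apply S ` cball 0 1 \<subseteq> ?C"
    proof
      fix w assume "w \<in> blinfun_apply S ` cball 0 1"
      then obtain v where v: "norm v \<le> 1" "w = blinfun_apply S v" by auto
      then show "w \<in> ?C" using RK[OF v(1)] norm_blinfun_on_ball[OF v(1), of f]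
        by (intro image_eqI[of _ _ "(blinfun_apply f v, R v)"]) (auto simp: S)
    qed
  qed
  have "S \<in> range_strongly_exposing sX sY"
  proof (rule range_strongly_exposingI[OF X Yb Sc f(1) _ nf])
    show "0 \<le> r" using r by simp
    show "norm (blinfun_apply S v) \<le> max (norm (blinfun_apply f v)) r" if v: "norm v \<le> 1" for v
      unfolding S
    proof (rule Y.norm_peak_le[OF ny r(1)])
      \<comment> \<open>The image of the ball under \<open>R\<close> is balanced, so \<open>u\<close> can be moved to the argument of \<open>R\<close>.\<close>
      fix u :: 'k assume u: "norm u = 1"
      then have "u \<noteq> 0" by auto
      have "sY (of_real r * u) y + R v = sY u (p + R (sX (inverse u) v))"
        using \<open>u \<noteq> 0\<close> by (simp add: R_scale Y.scale_right_distrib py Y.scale_scaleR flip: Y.scale_of_real)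
      also have "norm \<dots> \<le> r"
        unfolding Y.norm_scale using u v p(2)[OF RK[of "sX (inverse u) v"]]
        by (simp add: X.norm_scale norm_inverse)
      finally show "norm (sY (of_real r * u) y + R v) \<le> r" .
    qed
    show "norm (blinfun_apply f v) \<le> norm (blinfun_apply S v)" for v
    proof -
      have "blinfun_apply \<phi> (blinfun_apply S v) = blinfun_apply f v"
        by (simp add: S R_def blinfun.add_right blinfun.scaleR_right R0\<phi> dual_space_apply[OF \<phi>(1)] \<phi>y)
      then show ?thesis using \<phi>le[of "blinfun_apply S v"] by simp
    qed
  qed
  moreover have "norm (S - T) < e"
  proof -
    have "norm (S - T) \<le> \<delta> * (9 + 8 * \<tau>)"
    proof (rule norm_blinfun_le_on_ball)
      show "0 \<le> \<delta> * (9 + 8 * \<tau>)" using \<delta> \<tau> by simp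
      fix v :: 'a assume v: "norm v \<le> 1"
      let ?z = "R0 (blinfun_apply T v)"
      have "blinfun_apply (S - T) v = sY (blinfun_apply (f - f0) v) y +
          (sY (blinfun_apply f0 v) (y - y0) + - ((1 - \<rho>) *\<^sub>R ?z))"
        by (simp add: blinfun.diff_left S R_def R0_def f0(2) Y.scale_left_diff_distrib
            Y.scale_right_diff_distrib scaleR_left_diff_distrib)
      also have "norm \<dots> \<le> \<delta> * 1 + (\<tau> * (8 * \<delta>) + (4 * \<delta> / \<tau>) * (\<tau> + \<tau>))"
      proof (intro norm_triangle_mono)
        have "norm (blinfun_apply (f - f0) v) \<le> \<delta>"
          using norm_blinfun_on_ball[OF v, of "f - f0"] f(2) by (simp add: dist_norm)
        then show "norm (sY (blinfun_apply (f - f0) v) y) \<le> \<delta> * 1"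
          unfolding Y.norm_scale using ny \<delta> by (intro mult_mono) auto
        have "norm (blinfun_apply f0 v) \<le> \<tau>"
          using \<phi>le[of "blinfun_apply T v"] norm_blinfun_on_ball[OF v, of T] by (simp add: f0(2) \<tau>_def)
        then show "norm (sY (blinfun_apply f0 v) (y - y0)) \<le> \<tau> * (8 * \<delta>)"
          unfolding Y.norm_scale using yy0 \<tau> by (intro mult_mono) auto
        have "norm ?z \<le> \<tau> + \<tau>" using R0n[OF TK0[OF v]] \<eta> r by simp
        then show "norm (- ((1 - \<rho>) *\<^sub>R ?z)) \<le> (4 * \<delta> / \<tau>) * (\<tau> + \<tau>)"
          unfolding \<rho>(4) norm_minus_cancel norm_scaleR using \<delta> \<tau> by (intro mult_mono) auto
      qed
      also have "\<dots> = \<delta> * (9 + 8 * \<tau>)" using \<tau> by (simp add: algebra_simps)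
      finally show "norm (blinfun_apply (S - T) v) \<le> \<delta> * (9 + 8 * \<tau>)" .
    qed
    then show ?thesis using \<delta>(4) by simp
  qed
  ultimately show thesis using that Sc by blast
qed

theorem corollary4p8:
  fixes sX :: "'k::real_or_complex_field \<Rightarrow> 'a::banach \<Rightarrow> 'a"
    and sY :: "'k \<Rightarrow> 'b::banach \<Rightarrow> 'b"
  assumes "banach_space_over sX"
    and "dual_space sX \<subseteq> closure (smooth_dual_points sX \<inter> norm_attaining sX)"
    and "L1_predual TYPE('m) sY"
  shows "compact_ops sX sY = closure (compact_ops sX sY \<inter> range_strongly_exposing sX sY)"
proof (rule antisym)
  have Y: "banach_space_over sY" using assms(3) unfolding L1_predual_def by blast
  show "closure (compact_ops sX sY \<inter> range_strongly_exposing sX sY) \<subseteq> compact_ops sX sY"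
    by (rule closure_minimal) (use closed_compact_ops[OF Y] in auto)
  show "compact_ops sX sY \<subseteq> closure (compact_ops sX sY \<inter> range_strongly_exposing sX sY)"
  proof
    fix T assume T: "T \<in> compact_ops sX sY"
    show "T \<in> closure (compact_ops sX sY \<inter> range_strongly_exposing sX sY)"
    proof (cases "T = 0")
      case True
      then show ?thesis
        using T zero_op_range_strongly_exposing[OF assms(1) Y] closure_subset by blast
    next
      case False
      show ?thesis unfolding closure_approachable
      proof (intro allI impI)
        fix e :: real assume "e > 0"
        then obtain S where "S \<in> compact_ops sX sY \<inter> range_strongly_exposing sX sY" "norm (S - T) < e"
          using compact_op_near_range_strongly_exposing[OF assms T False] by blast
        then show "\<exists>S\<in>compact_ops sX sY \<inter> range_strongly_exposing sX sY. dist S T < e"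
          by (auto simp: dist_norm)
      qed
    qed
  qed
qed

end
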